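(* Let $N\ge 2$, and let $\mathscr F\subset C^{0,1}_{\mathrm{loc}}(\mathbb R^N;\mathbb R^N)$ be a linear space of locally Lipschitz vector fields such that every $V\in\mathscr F$ generates a global flow $(\Phi_V^t)_{t\in\mathbb R}$. Assume that for every $u\in C_c^\infty(\mathbb R^N;\mathbb R^N)$, every $R>0$ and every $\varepsilon>0$ there exists $V\in\mathscr F$ such that $$\sup_{|x|\le R}|V(x)-u(x)|<\varepsilon .$$ Then, for every $T>0$ and every admissible finite correspondence $\{(x_i,y_i)\}_{i=1}^M\subset\mathbb R^N\times\mathbb R^N$, there exists $V\in\mathscr F$ such that $\Phi_V^T(x_i)=y_i$ for all $i=1,\ldots,M$.
   Context: $M\ge1$ is an integer. A finite correspondence (dataset) $\{(x_i,y_i)\}_{i=1}^M\subset\mathbb R^N\times\mathbb R^N$ is admissible if the inputs $x_1,\dots,x_M$ are pairwise distinct and the targets $y_1,\dots,y_M$ are pairwise distinct. Relations $x_i=y_i$ and $y_i=x_j$ are allowed. For a locally Lipschitz autonomous vector field $V$ whose solutions of $\dot z=V(z)$ exist for all times, $\Phi_V^t$ denotes its flow: $t\mapsto\Phi_V^t(x)$ is the solution with $z(0)=x$. $|\cdot|$ is the Euclidean norm. *)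

theory Defs
  imports "HOL-Analysis.Analysis" "HOL-Library.Function_Algebras"
begin

text \<open>The library declares no \<open>real_vector\<close> instance on function types, so linear spaces of vector
  fields are subspaces for an explicit pointwise scalar multiplication; the underlying abelian group
  is the pointwise one.\<close>

definition scale_field :: "real \<Rightarrow> ('a \<Rightarrow> 'b) \<Rightarrow> 'a \<Rightarrow> 'b::real_vector" where
  "scale_field c V = (\<lambda>x. c *\<^sub>R V x)"

interpretation field_space: vector_space scale_field
  by unfold_locales (auto simp: scale_field_def fun_eq_iff scaleR_add_right scaleR_add_left)

text \<open>The continuity demanded at order \<open>0\<close> is that of all iterated directional derivatives of order
  \<open>k\<close>. On a finite-dimensional domain this is class \<open>C\<^sup>k\<close> on the whole space.\<close>

fun Ck :: "nat \<Rightarrow> ('a::real_normed_vector \<Rightarrow> 'b::real_normed_vector) \<Rightarrow> bool" where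
  "Ck 0 f \<longleftrightarrow> continuous_on UNIV f"
| "Ck (Suc k) f \<longleftrightarrow>
     (\<forall>x. f differentiable (at x)) \<and> (\<forall>v. Ck k (\<lambda>x. frechet_derivative f (at x) v))"

definition Cc_infinity :: "('a::real_normed_vector \<Rightarrow> 'b::real_normed_vector) set" where
  "Cc_infinity = {u. (\<forall>k. Ck k u) \<and> compact (closure (support_on UNIV u))}"

text \<open>\<open>local_lipschitz\<close> concerns time-dependent maps; an autonomous field is constant in time.\<close>

definition locally_lipschitz :: "('a::metric_space \<Rightarrow> 'b::metric_space) \<Rightarrow> bool" where
  "locally_lipschitz V \<longleftrightarrow> local_lipschitz (UNIV :: real set) UNIV (\<lambda>_. V)"

definition is_trajectory ::
  "('a::real_normed_vector \<Rightarrow> 'a) \<Rightarrow> 'a \<Rightarrow> (real \<Rightarrow> 'a) \<Rightarrow> bool" where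
  "is_trajectory V x z \<longleftrightarrow>
     z 0 = x \<and> (\<forall>t. (z has_vector_derivative V (z t)) (at t))"

definition generates_global_flow :: "('a::real_normed_vector \<Rightarrow> 'a) \<Rightarrow> bool" where
  "generates_global_flow V \<longleftrightarrow> (\<forall>x. \<exists>z. is_trajectory V x z)"

text \<open>Trajectories of a locally Lipschitz field are unique, so for such a field generating a global
  flow the description below is proper; otherwise its value is unspecified.\<close>

definition flow :: "('a::real_normed_vector \<Rightarrow> 'a) \<Rightarrow> real \<Rightarrow> 'a \<Rightarrow> 'a" where
  "flow V t x = (THE z. is_trajectory V x z) t"

definition admissible :: "nat \<Rightarrow> (nat \<Rightarrow> 'a) \<Rightarrow> (nat \<Rightarrow> 'a) \<Rightarrow> bool" where
  "admissible M x y \<longleftrightarrow> inj_on x {1..M} \<and> inj_on y {1..M}"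

end

(*
  Uniform density on balls extends from compactly supported smooth fields to all continuous fields,
  so it suffices to build one continuous model field together with finitely many perturbations.

  The partial injection x_i -> y_i extends to a permutation sigma of the finite set S of all points
  involved. By two polynomial shears (this needs N >= 2) the points of S can be moved into a plane
  so that every cycle of length k lies equally spaced on a circle of its own. In these coordinates the
  field that rotates each circle with angular velocity 2 pi / (k T) has time-T map sigma on S. For every
  s in S and every direction e, add a perturbation supported near the midpoint of the arc from s to
  sigma(s). Seen in the rotating frame, the endpoint of the trajectory from s then moves, to first
  order, by a positive multiple of the parameter vector attached to s. Replacing the model field and
  the perturbations by close fields of the linear space changes the endpoints little, and they still
  depend continuously on the parameters. The Poincare-Miranda theorem yields parameters for which all
  endpoints are exact.
*)
theory Submission
  imports Defs "HOL-Computational_Algebra.Polynomial" "HOL-Combinatorics.Cycles"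
begin

section \<open>Density in the continuous fields\<close>

text \<open>The hypothesis gives closeness in the sup norm only, so nothing is known about the
  Lipschitz constants of the approximating fields, and endpoint estimates have to rest on the model
  alone. This is why the model is an exact linear rotation near each circle: it vanishes in the
  rotating frame, and what remains is the sup error and the Lipschitz constant of an explicit
  perturbation. For the same reason no derivative of the endpoints in the parameters is taken;
  Poincare-Miranda asks only for continuity and for signs on the faces of a cube. The signs come
  from a separation of scales: a parameter of size \<rho> moves an endpoint by an amount of order
  \<rho>, while all errors are of order \<rho>^2. Cycles appear because the field is autonomous: a
  point that is both a target and an input has to travel on along the same trajectory. Completing
  chains to cycles treats all points alike, a fixed point of \<sigma> making one full turn in time
  T. The perturbations sit at midpoints of arcs because consecutive arcs of a cycle share their
  endpoints.\<close>

definition bump :: "real \<Rightarrow> real poly \<Rightarrow> real \<Rightarrow> real" where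
  "bump c p s = (if s < c then poly p (1 / (c - s)) * exp (- (1 / (c - s))) else 0)"

lemma poly_exp_tendsto_0: "((\<lambda>w. poly p w * exp (- w)) \<longlongrightarrow> (0::real)) at_top"
proof -
  have "((\<lambda>w. \<Sum>i\<le>degree p. coeff p i * (w ^ i / exp w)) \<longlongrightarrow> (\<Sum>i\<le>degree p. coeff p i * 0)) at_top"
    by (intro tendsto_intros tendsto_power_div_exp_0)
  moreover have "(\<lambda>w. \<Sum>i\<le>degree p. coeff p i * (w ^ i / exp w)) = (\<lambda>w. poly p w * exp (- w))"
    by (rule ext) (simp add: poly_altdef sum_distrib_right exp_minus divide_inverse mult.assoc)
  ultimately show ?thesis by simp
qed

lemma bump_tendsto_0: "(bump c p \<longlongrightarrow> 0) (at c)"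
proof -
  have "((\<lambda>w. poly p (1 / w) * exp (- (1 / w))) \<longlongrightarrow> 0) (at_right 0)"
    using poly_exp_tendsto_0[of p] unfolding at_right_to_top filterlim_filtermap
    by (simp add: inverse_eq_divide)
  then have "((\<lambda>s. poly p (1 / (c - s)) * exp (- (1 / (c - s)))) \<longlongrightarrow> 0) (at_left c)"
    unfolding filterlim_at_left_to_right[of _ _ c] filterlim_at_right_to_0[of _ _ "- c"] by simp
  then have l: "(bump c p \<longlongrightarrow> 0) (at_left c)"
    by (rule Lim_transform_eventually)
       (auto simp: bump_def eventually_at_filter)
  have r: "(bump c p \<longlongrightarrow> 0) (at_right c)"
    by (rule Lim_transform_eventually[of "\<lambda>_. 0"])
       (auto simp: bump_def eventually_at_filter)
  show ?thesis using l r by (rule filterlim_split_at)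
qed

text \<open>With w = 1 / (c - s) one has dw/ds = w^2, so p(w) exp(-w) has derivative (p' - p)(w) w^2
  exp(-w). The polynomial argument of \<open>bump\<close> exists to make the family closed under
  this operation.\<close>

definition bump_deriv :: "real poly \<Rightarrow> real poly" where
  "bump_deriv p = (pderiv p - p) * [:0, 0, 1:]"

lemma bump_has_derivative: "(bump c p has_real_derivative bump c (bump_deriv p) s) (at s)"
proof -
  consider "s < c" | "s > c" | "s = c" by linarith
  then show ?thesis
  proof cases
    case 1
    have w: "((\<lambda>s. 1 / (c - s)) has_real_derivative (1 / (c - s))\<^sup>2) (at s)"
      using 1 by (auto intro!: derivative_eq_intros simp: power2_eq_square)
    have "((\<lambda>s. poly p (1 / (c - s)) * exp (- (1 / (c - s)))) has_real_derivative
        poly (pderiv p) (1 / (c - s)) * (1 / (c - s))\<^sup>2 * exp (- (1 / (c - s)))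
        + exp (- (1 / (c - s))) * (- (1 / (c - s))\<^sup>2) * poly p (1 / (c - s))) (at s)"
      by (intro DERIV_mult DERIV_chain2[OF poly_DERIV w] DERIV_chain2[OF DERIV_exp] DERIV_minus w)
    also have "poly (pderiv p) (1 / (c - s)) * (1 / (c - s))\<^sup>2 * exp (- (1 / (c - s)))
        + exp (- (1 / (c - s))) * (- (1 / (c - s))\<^sup>2) * poly p (1 / (c - s)) = bump c (bump_deriv p) s"
      using 1 by (simp add: bump_def bump_deriv_def power2_eq_square algebra_simps)
    finally have "((\<lambda>s. poly p (1 / (c - s)) * exp (- (1 / (c - s)))) has_real_derivative bump c (bump_deriv p) s) (at s)" .
    then show ?thesis
      by (rule has_field_derivative_transform_within_open[of _ _ _ "{..<c}"])
         (use 1 in \<open>auto simp: bump_def\<close>)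
  next
    case 2
    have "((\<lambda>_. 0) has_real_derivative bump c (bump_deriv p) s) (at s)"
      using 2 by (simp add: bump_def)
    then show ?thesis
      by (rule has_field_derivative_transform_within_open[of _ _ _ "{c<..}"])
         (use 2 in \<open>auto simp: bump_def\<close>)
  next
    case 3
    \<comment> \<open>At the gluing point the difference quotient is again a bump up to sign, with
      one more factor 1 / (c - s), so the limit already proved applies to it.\<close>
    have "((\<lambda>s. - bump c (p * [:0, 1:]) s) \<longlongrightarrow> 0) (at c)"
      using tendsto_minus[OF bump_tendsto_0[of c "p * [:0, 1:]"]] by simp
    moreover have "- bump c (p * [:0, 1:]) s = (bump c p s - bump c p c) / (s - c)" for s
      by (auto simp add: bump_def divide_simps algebra_simps)
    ultimately have "((\<lambda>s. (bump c p s - bump c p c) / (s - c)) \<longlongrightarrow> 0) (at c)"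
      by simp
    then show ?thesis
      using 3 by (simp add: has_field_derivative_iff bump_def)
  qed
qed

lemma bump_1_pos: "s < c \<Longrightarrow> bump c 1 s > 0"
  by (simp add: bump_def)

lemma bump_1_le_1: "bump c 1 s \<le> 1"
  by (simp add: bump_def)

lemma continuous_on_bump [continuous_intros]:
  assumes "continuous_on S g" shows "continuous_on S (\<lambda>x. bump c p (g x))"
proof -
  have "continuous_on UNIV (bump c p)"
    using bump_has_derivative by (meson DERIV_isCont continuous_at_imp_continuous_on)
  with assms show ?thesis
    by (auto intro: continuous_on_compose2)
qed

section \<open>Smooth compactly supported fields from bumps and polynomials\<close>

lemma real_polynomial_function_has_derivative:
  assumes "real_polynomial_function q"
  shows "\<exists>q'. (\<forall>x. (q has_derivative q' x) (at x)) \<and> (\<forall>v. real_polynomial_function (\<lambda>x. q' x v))"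
  using assms
proof induction
  case (linear f)
  then show ?case
    by (intro exI[of _ "\<lambda>x. f"]) (auto intro: bounded_linear.has_derivative[OF _ has_derivative_ident, simplified] bounded_linear_imp_has_derivative)
next
  case (const c)
  then show ?case by (intro exI[of _ "\<lambda>x v. 0"]) auto
next
  case (add f g)
  then obtain f' g' where "\<forall>x. (f has_derivative f' x) (at x)" "\<forall>v. real_polynomial_function (\<lambda>x. f' x v)"
    "\<forall>x. (g has_derivative g' x) (at x)" "\<forall>v. real_polynomial_function (\<lambda>x. g' x v)" by blast
  then show ?case
    by (intro exI[of _ "\<lambda>x v. f' x v + g' x v"]) (auto intro!: derivative_intros)
next
  case (mult f g)
  then obtain f' g' where "\<forall>x. (f has_derivative f' x) (at x)" "\<forall>v. real_polynomial_function (\<lambda>x. f' x v)"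
    "\<forall>x. (g has_derivative g' x) (at x)" "\<forall>v. real_polynomial_function (\<lambda>x. g' x v)" by blast
  with mult.hyps show ?case
    by (intro exI[of _ "\<lambda>x v. f x * g' x v + f' x v * g x"] conjI allI has_derivative_mult
          real_polynomial_function.intros(3,4)) auto
qed

text \<open>\<open>Ck\<close> is defined by iterated directional derivatives, so smoothness by
  induction needs a class closed under them. By the product rule the derivative of a basic term is a
  sum of two such terms.\<close>

inductive bump_field :: "real \<Rightarrow> ('a::euclidean_space \<Rightarrow> 'b::real_normed_vector) \<Rightarrow> bool" for c where
  base: "real_polynomial_function q \<Longrightarrow> bump_field c (\<lambda>x. (bump c p (x \<bullet> x) * q x) *\<^sub>R e)"
| add: "bump_field c f \<Longrightarrow> bump_field c g \<Longrightarrow> bump_field c (\<lambda>x. f x + g x)"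

lemma bump_field_zero: "bump_field c (\<lambda>x. 0)"
  using bump_field.base[of "\<lambda>x. 0" c 0 0] by auto

lemma bump_field_sum:
  "finite I \<Longrightarrow> (\<And>i. i \<in> I \<Longrightarrow> bump_field c (f i)) \<Longrightarrow> bump_field c (\<lambda>x. \<Sum>i\<in>I. f i x)"
  by (induction I rule: finite_induct) (auto intro: bump_field_zero bump_field.add)

lemma bump_field_has_derivative:
  assumes "bump_field c f"
  shows "\<exists>f'. (\<forall>x. (f has_derivative f' x) (at x)) \<and> (\<forall>v. bump_field c (\<lambda>x. f' x v))"
  using assms
proof induction
  case (base q p e)
  obtain q' where q': "\<And>x. (q has_derivative q' x) (at x)" "\<And>v. real_polynomial_function (\<lambda>x. q' x v)"
    using real_polynomial_function_has_derivative[OF base] by blast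
  let ?f' = "\<lambda>x v. (bump c p (x \<bullet> x) * q' x v) *\<^sub>R e
      + (bump c (bump_deriv p) (x \<bullet> x) * (2 * (x \<bullet> v) * q x)) *\<^sub>R e"
  have "((\<lambda>x. (bump c p (x \<bullet> x) * q x) *\<^sub>R e) has_derivative ?f' x) (at x)" for x
  proof -
    have "((\<lambda>x. bump c p (x \<bullet> x)) has_derivative (\<lambda>v. (2 * (x \<bullet> v)) * bump c (bump_deriv p) (x \<bullet> x))) (at x)"
      by (rule has_derivative_eq_rhs[OF DERIV_compose_FDERIV[OF bump_has_derivative]])
         (auto intro!: derivative_eq_intros simp: inner_commute)
    from has_derivative_mult[OF this q'(1)] show ?thesis
      by (rule has_derivative_eq_rhs[OF has_derivative_scaleR_left]) (auto simp: algebra_simps)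
  qed
  moreover have "real_polynomial_function (\<lambda>x. 2 * (x \<bullet> v) * q x)" for v
    by (intro real_polynomial_function.intros base bounded_linear_inner_left)
  ultimately show ?case
    using q'(2) by (intro exI[of _ ?f']) (auto intro!: bump_field.intros)
next
  case (add f g)
  then obtain f' g' where "\<forall>x. (f has_derivative f' x) (at x)" "\<forall>v. bump_field c (\<lambda>x. f' x v)"
    "\<forall>x. (g has_derivative g' x) (at x)" "\<forall>v. bump_field c (\<lambda>x. g' x v)" by blast
  then show ?case
    by (intro exI[of _ "\<lambda>x v. f' x v + g' x v"]) (auto intro!: derivative_intros bump_field.add)
qed

lemma Ck_bump_field: "bump_field c f \<Longrightarrow> Ck k f"
proof (induction k arbitrary: f)
  case 0
  then obtain f' where "\<And>x. (f has_derivative f' x) (at x)"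
    using bump_field_has_derivative by blast
  then show ?case
    by (auto intro!: continuous_at_imp_continuous_on has_derivative_continuous)
next
  case (Suc k)
  then obtain f' where f': "\<And>x. (f has_derivative f' x) (at x)" "\<And>v. bump_field c (\<lambda>x. f' x v)"
    using bump_field_has_derivative by blast
  then show ?case
    using Suc.IH by (auto simp: differentiable_def frechet_derivative_at[OF f'(1), symmetric])
qed

lemma bump_field_eq_0: "bump_field c f \<Longrightarrow> c \<le> x \<bullet> x \<Longrightarrow> f x = 0"
  by (induction rule: bump_field.induct) (auto simp: bump_def)

lemma bump_field_in_Cc_infinity:
  fixes f :: "'a::euclidean_space \<Rightarrow> 'b::real_normed_vector"
  assumes "bump_field c f"
  shows "f \<in> Cc_infinity"
proof -
  have "support_on UNIV f \<subseteq> cball 0 (sqrt \<bar>c\<bar>)"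
  proof
    fix x assume "x \<in> support_on UNIV f"
    then have "x \<bullet> x < c"
      using bump_field_eq_0[OF assms, of x] by (force simp: support_on_def)
    then have "norm x \<le> sqrt \<bar>c\<bar>"
      by (simp add: norm_eq_sqrt_inner)
    then show "x \<in> cball 0 (sqrt \<bar>c\<bar>)" by simp
  qed
  then have "bounded (support_on UNIV f)"
    using bounded_cball bounded_subset by blast
  then show ?thesis
    using assms by (auto simp: Cc_infinity_def Ck_bump_field)
qed

text \<open>No plateau function is needed: the polynomial approximates \<open>U\<close> divided by the bump.\<close>

lemma Cc_infinity_dense:
  fixes U :: "'a::euclidean_space \<Rightarrow> 'b::euclidean_space"
  assumes U: "continuous_on UNIV U" and e: "e > 0"
  obtains u where "u \<in> Cc_infinity" "\<And>x. norm x \<le> R \<Longrightarrow> norm (u x - U x) < e"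
proof -
  \<comment> \<open>The bump in \<open>x \<bullet> x\<close> then stays positive on the closed ball
    of radius \<open>R\<close> and may be divided by there. Since it is at most 1, multiplying back
    does not enlarge the error.\<close>
  define c where "c = R\<^sup>2 + 1"
  have pos: "bump c 1 (x \<bullet> x) > 0" if "norm x \<le> R" for x :: 'a
    using that power_mono[of "norm x" R 2]
    by (intro bump_1_pos) (auto simp: c_def power2_norm_eq_inner)
  have "continuous_on (cball 0 R) (\<lambda>x. U x /\<^sub>R bump c 1 (x \<bullet> x))"
    using pos by (intro continuous_intros continuous_on_subset[OF U]) (force simp: less_imp_neq)+
  then obtain g where g: "polynomial_function g"
    and gU: "\<And>x. x \<in> cball 0 R \<Longrightarrow> norm (U x /\<^sub>R bump c 1 (x \<bullet> x) - g x) < e"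
    using Stone_Weierstrass_polynomial_function[OF compact_cball _ e, of 0 R "\<lambda>x. U x /\<^sub>R bump c 1 (x \<bullet> x)"] by blast
  define u where "u = (\<lambda>x. bump c 1 (x \<bullet> x) *\<^sub>R g x)"
  have u_eq: "u = (\<lambda>x. \<Sum>b\<in>Basis. (bump c 1 (x \<bullet> x) * (g x \<bullet> b)) *\<^sub>R b)"
    unfolding u_def
    by (rule ext) (simp only: scaleR_scaleR[symmetric] scaleR_sum_right[symmetric] euclidean_representation)
  have "bump_field c (\<lambda>x. \<Sum>b\<in>Basis. (bump c 1 (x \<bullet> x) * (g x \<bullet> b)) *\<^sub>R b)"
    using g by (intro bump_field_sum bump_field.base) (auto simp: polynomial_function_iff_Basis_inner)
  then have "u \<in> Cc_infinity"
    unfolding u_eq by (rule bump_field_in_Cc_infinity)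
  moreover have "norm (u x - U x) < e" if "norm x \<le> R" for x
  proof -
    have "u x - U x = - (bump c 1 (x \<bullet> x) *\<^sub>R (U x /\<^sub>R bump c 1 (x \<bullet> x) - g x))"
      using pos[OF that] by (simp add: u_def algebra_simps)
    then have "norm (u x - U x) = bump c 1 (x \<bullet> x) * norm (U x /\<^sub>R bump c 1 (x \<bullet> x) - g x)"
      using pos[OF that] by simp
    also have "\<dots> \<le> 1 * norm (U x /\<^sub>R bump c 1 (x \<bullet> x) - g x)"
      by (intro mult_right_mono bump_1_le_1) auto
    finally show ?thesis
      using gU[of x] that by simp
  qed
  ultimately show thesis by (rule that)
qed

lemma locally_lipschitz_imp_continuous:
  assumes "locally_lipschitz V" shows "continuous_on UNIV V"
  using assms unfolding locally_lipschitz_def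
  by (auto intro!: local_lipschitz_continuous_on[of UNIV UNIV "\<lambda>_. V"])

lemma dense_in_continuous_fields:
  fixes \<F> :: "('a::euclidean_space \<Rightarrow> 'a) set"
  assumes lip: "\<And>V. V \<in> \<F> \<Longrightarrow> locally_lipschitz V"
    and dense: "\<And>u R \<epsilon>. u \<in> Cc_infinity \<Longrightarrow> R > 0 \<Longrightarrow> \<epsilon> > 0 \<Longrightarrow>
           \<exists>V\<in>\<F>. (SUP x\<in>cball 0 R. norm (V x - u x)) < (\<epsilon>::real)"
    and U: "continuous_on UNIV U" and e: "e > 0"
  obtains V where "V \<in> \<F>" "\<And>x. norm x \<le> R \<Longrightarrow> norm (V x - U x) < e"
proof -
  \<comment> \<open>The density hypothesis speaks of positive radii, whereas \<open>R\<close> is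
    arbitrary here.\<close>
  define R' where "R' = max R 1"
  obtain u where u: "u \<in> Cc_infinity" "\<And>x. norm x \<le> R' \<Longrightarrow> norm (u x - U x) < e / 2"
    using Cc_infinity_dense[OF U, of "e/2" R'] e by auto
  obtain V where V: "V \<in> \<F>" "(SUP x\<in>cball 0 R'. norm (V x - u x)) < e / 2"
    using dense[OF u(1), of R' "e/2"] e by (auto simp: R'_def less_max_iff_disj)
  have "Ck 0 u" using u(1) by (auto simp: Cc_infinity_def simp del: Ck.simps)
  then have "continuous_on UNIV u" by simp
  then have "continuous_on (cball 0 R') (\<lambda>x. norm (V x - u x))"
    using locally_lipschitz_imp_continuous[OF lip[OF V(1)]]
    by (auto intro!: continuous_intros intro: continuous_on_subset)
  \<comment> \<open>A bound on the real \<open>SUP\<close> controls the single values only if the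
    set is bounded above; compactness of the ball supplies this.\<close>
  then have bdd: "bdd_above ((\<lambda>x. norm (V x - u x)) ` cball 0 R')"
    by (intro bounded_imp_bdd_above compact_imp_bounded compact_continuous_image) auto
  show thesis
  proof (rule that[OF V(1)])
    fix x :: 'a assume x: "norm x \<le> R"
    then have "norm (V x - u x) < e / 2"
      using cSUP_upper[OF _ bdd, of x] V(2) by (auto simp: R'_def le_max_iff_disj)
    moreover have "norm (u x - U x) < e / 2"
      using u(2)[of x] x by (simp add: R'_def le_max_iff_disj)
    ultimately show "norm (V x - U x) < e"
      using norm_triangle_ineq[of "V x - u x" "u x - U x"] by simp
  qed
qed

section \<open>The Poincare-Miranda theorem\<close>

lemma tendsto_fun_iff:
  fixes u :: "'b \<Rightarrow> 'i \<Rightarrow> 'a::topological_space"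
  shows "(u \<longlongrightarrow> l) F \<longleftrightarrow> (\<forall>i. ((\<lambda>k. u k i) \<longlongrightarrow> l i) F)"
  using limitin_componentwise[of "\<lambda>_. euclidean" UNIV u l F]
  by (simp add: euclidean_product_topology limitin_canonical_iff)

lemma compact_cube_fun:
  "compact {x :: 'i \<Rightarrow> real. \<forall>i. \<bar>x i\<bar> \<le> r}"
proof -
  have "{x :: 'i \<Rightarrow> real. \<forall>i. \<bar>x i\<bar> \<le> r} = PiE UNIV (\<lambda>_. {-r..r})"
    by (auto simp: PiE_def abs_le_iff Pi_iff minus_le_iff)
  then show ?thesis
    using compactin_PiE[of "\<lambda>_::'i. euclideanreal" UNIV "\<lambda>_. {-r..r}"]
    by (simp add: euclidean_product_topology compactin_euclidean_iff[symmetric] del: compactin_euclidean_iff)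
       (simp add: compactin_euclidean_iff)
qed

text \<open>The dimension \<open>n\<close> is a number here, since the parameter space below has a dimension depending on
  the number of points; this rules out the library's Brouwer theorem, whose dimension is a type.\<close>

theorem poincare_miranda:
  fixes f :: "(nat \<Rightarrow> real) \<Rightarrow> nat \<Rightarrow> real"
  assumes r: "r > 0"
    and cont: "\<And>i. i < n \<Longrightarrow> continuous_on UNIV (\<lambda>x. f x i)"
    and lo: "\<And>i x. i < n \<Longrightarrow> \<forall>j. \<bar>x j\<bar> \<le> r \<Longrightarrow> x i = - r \<Longrightarrow> f x i \<le> 0"
    and hi: "\<And>i x. i < n \<Longrightarrow> \<forall>j. \<bar>x j\<bar> \<le> r \<Longrightarrow> x i = r \<Longrightarrow> f x i \<ge> 0"
  obtains x where "\<forall>j. \<bar>x j\<bar> \<le> r" "\<And>i. i < n \<Longrightarrow> f x i = 0"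
proof -
  \<comment> \<open>Embeds the integer grid with coordinates 0 to \<open>m\<close> into the cube.
    Coordinates from \<open>n\<close> on are frozen at 0, so grid points lie in the cube that is
    compact by Tychonoff.\<close>
  define G where "G m x = (\<lambda>j::nat. if j < n then - r + 2 * r * real (x j) / real m else 0)" for m and x :: "nat \<Rightarrow> nat"
  have G_cube: "\<forall>j. \<bar>G m x j\<bar> \<le> r" if "\<forall>j<n. x j \<le> m" "m > 0" for m x
  proof
    fix j
    show "\<bar>G m x j\<bar> \<le> r"
    proof (cases "j < n")
      case True
      have q: "real (x j) / real m \<ge> 0" "real (x j) / real m \<le> 1"
        using that True by (auto simp: divide_le_eq_1)
      have "r * (real (x j) / real m) \<le> r * 1"
        by (rule mult_left_mono) (use q r in auto)
      moreover have "0 \<le> r * (real (x j) / real m)" using q r by simp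
      ultimately show ?thesis
        using True by (auto simp: G_def abs_le_iff)
    qed (use r in \<open>simp add: G_def\<close>)
  qed
  have cell: "\<exists>q. (\<forall>j<n. q j < Suc k) \<and> (\<forall>i<n. \<exists>u v.
      (\<forall>j<n. q j \<le> u j \<and> u j \<le> q j + 1) \<and> (\<forall>j<n. q j \<le> v j \<and> v j \<le> q j + 1) \<and>
      f (G (Suc k) u) i \<le> 0 \<and> 0 \<le> f (G (Suc k) v) i)" for k
  proof -
    \<comment> \<open>Kuhn labelling by the sign of \<open>f\<close>. On an upper face the label is
      forced to be 1, which \<open>hi\<close> makes consistent with a nonnegative value; on a lower
      face \<open>lo\<close> yields 0. A cell with both labels in every coordinate therefore has
      vertices with both weak signs.\<close>
    define label where "label x i = (if x i = Suc k \<or> f (G (Suc k) x) i > 0 then 1 else 0::nat)" for x i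
    have l0: "label x i = 0 \<Longrightarrow> f (G (Suc k) x) i \<le> 0" for x i
      by (auto simp: label_def split: if_splits)
    have l1: "f (G (Suc k) x) i \<ge> 0" if "label x i = 1" "\<forall>j<n. x j \<le> Suc k" "i < n" for x i
    proof (cases "x i = Suc k")
      case True
      then have "G (Suc k) x i = r" using that by (simp add: G_def del: of_nat_Suc)
      then show ?thesis using hi[OF that(3)] G_cube[OF that(2)] by auto
    qed (use that in \<open>auto simp: label_def split: if_splits\<close>)
    have l2: "label x i = 0" if "x i = 0" "\<forall>j<n. x j \<le> Suc k" "i < n" for x i
    proof -
      have "G (Suc k) x i = - r" using that by (simp add: G_def)
      then have "f (G (Suc k) x) i \<le> 0" using lo[OF that(3)] G_cube[OF that(2)] by auto
      then show ?thesis using that by (simp add: label_def)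
    qed
    obtain q where q: "\<forall>i<n. q i < Suc k"
      "\<forall>i<n. \<exists>u v. (\<forall>j<n. q j \<le> u j \<and> u j \<le> q j + 1) \<and> (\<forall>j<n. q j \<le> v j \<and> v j \<le> q j + 1) \<and> label u i \<noteq> label v i"
      using l2 by (rule_tac kuhn_lemma[of "Suc k" n label]) (auto simp: label_def)
    have "\<exists>u v. (\<forall>j<n. q j \<le> u j \<and> u j \<le> q j + 1) \<and> (\<forall>j<n. q j \<le> v j \<and> v j \<le> q j + 1) \<and>
      f (G (Suc k) u) i \<le> 0 \<and> 0 \<le> f (G (Suc k) v) i" if i: "i < n" for i
    proof -
      obtain u v where uv: "\<forall>j<n. q j \<le> u j \<and> u j \<le> q j + 1" "\<forall>j<n. q j \<le> v j \<and> v j \<le> q j + 1"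
        "label u i \<noteq> label v i" using q(2) i by blast
      have le: "\<forall>j<n. u j \<le> Suc k" "\<forall>j<n. v j \<le> Suc k"
        using uv q(1) by (fastforce simp: less_Suc_eq_le)+
      consider "label u i = 0" "label v i = 1" | "label v i = 0" "label u i = 1"
        using uv(3) by (auto simp: label_def split: if_splits)
      then show ?thesis
      proof cases
        case 1
        then have "f (G (Suc k) u) i \<le> 0" "0 \<le> f (G (Suc k) v) i" using l0 l1 le i by auto
        then show ?thesis using uv by blast
      next
        case 2
        then have "f (G (Suc k) v) i \<le> 0" "0 \<le> f (G (Suc k) u) i" using l0 l1 le i by auto
        then show ?thesis using uv by blast
      qed
    qed
    then show ?thesis using q(1) by blast
  qed
  then obtain q where q1: "\<And>k j. j < n \<Longrightarrow> q k j < Suc k"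
    and q2: "\<And>k i. i < n \<Longrightarrow> \<exists>u v.
      (\<forall>j<n. q k j \<le> u j \<and> u j \<le> q k j + 1) \<and> (\<forall>j<n. q k j \<le> v j \<and> v j \<le> q k j + 1) \<and>
      f (G (Suc k) u) i \<le> 0 \<and> 0 \<le> f (G (Suc k) v) i"
    by metis
  have "seq_compact {x :: nat \<Rightarrow> real. \<forall>i. \<bar>x i\<bar> \<le> r}"
    by (simp add: compact_cube_fun compact_imp_seq_compact)
  moreover have "\<forall>k. G (Suc k) (q k) \<in> {x. \<forall>i. \<bar>x i\<bar> \<le> r}"
    using G_cube q1 by (auto simp: less_imp_le)
  ultimately obtain l \<sigma> where l: "\<forall>i. \<bar>l i\<bar> \<le> r" and \<sigma>: "strict_mono (\<sigma> :: nat \<Rightarrow> nat)"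
    and lim: "((\<lambda>k. G (Suc k) (q k)) \<circ> \<sigma>) \<longlonglongrightarrow> l"
    by (elim seq_compactE) auto
  \<comment> \<open>Cell diameters shrink to 0, so any choice of vertices, one per cell, has the
    same limit as the corners \<open>q\<close>.\<close>
  have near: "(\<lambda>k. G (Suc (\<sigma> k)) (u k)) \<longlonglongrightarrow> l"
    if u: "\<And>k j. j < n \<Longrightarrow> q (\<sigma> k) j \<le> u k j \<and> u k j \<le> q (\<sigma> k) j + 1" for u
    unfolding tendsto_fun_iff
  proof
    fix j
    have "(\<lambda>k. 2 * r / real (Suc k)) \<longlonglongrightarrow> 0"
      by (rule real_tendsto_divide_at_top[OF tendsto_const filterlim_compose[OF filterlim_real_sequentially filterlim_Suc]])
    from LIMSEQ_subseq_LIMSEQ[OF this \<sigma>] have "(\<lambda>k. 2 * r / real (Suc (\<sigma> k))) \<longlonglongrightarrow> 0"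
      by (simp add: o_def)
    then have "(\<lambda>k. G (Suc (\<sigma> k)) (u k) j - G (Suc (\<sigma> k)) (q (\<sigma> k)) j) \<longlonglongrightarrow> 0"
    proof (rule Lim_null_comparison[rotated], intro always_eventually allI)
      fix k
      show "norm (G (Suc (\<sigma> k)) (u k) j - G (Suc (\<sigma> k)) (q (\<sigma> k)) j) \<le> 2 * r / real (Suc (\<sigma> k))"
      proof (cases "j < n")
        case True
        have "G (Suc (\<sigma> k)) (u k) j - G (Suc (\<sigma> k)) (q (\<sigma> k)) j
            = 2 * r / real (Suc (\<sigma> k)) * (real (u k j) - real (q (\<sigma> k) j))"
          using True by (simp add: G_def diff_divide_distrib[symmetric] right_diff_distrib del: of_nat_Suc)
        also have "norm \<dots> \<le> 2 * r / real (Suc (\<sigma> k)) * 1"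
          unfolding norm_mult
          by (rule mult_mono) (use u[OF True, of k] r in \<open>auto simp del: of_nat_Suc\<close>)
        finally show ?thesis by simp
      qed (use r in \<open>simp add: G_def del: of_nat_Suc\<close>)
    qed
    moreover have "(\<lambda>k. G (Suc (\<sigma> k)) (q (\<sigma> k)) j) \<longlonglongrightarrow> l j"
      using lim unfolding tendsto_fun_iff by (simp add: o_def)
    ultimately show "(\<lambda>k. G (Suc (\<sigma> k)) (u k) j) \<longlonglongrightarrow> l j"
      using tendsto_add by fastforce
  qed
  have "f l i = 0" if i: "i < n" for i
  proof -
    have "\<exists>u v. (\<forall>j<n. q (\<sigma> k) j \<le> u j \<and> u j \<le> q (\<sigma> k) j + 1) \<and>
      (\<forall>j<n. q (\<sigma> k) j \<le> v j \<and> v j \<le> q (\<sigma> k) j + 1) \<and>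
      f (G (Suc (\<sigma> k)) u) i \<le> 0 \<and> 0 \<le> f (G (Suc (\<sigma> k)) v) i" for k
      using q2[OF i] .
    then obtain u v where uv: "\<And>k j. j < n \<Longrightarrow> q (\<sigma> k) j \<le> u k j \<and> u k j \<le> q (\<sigma> k) j + 1"
      "\<And>k j. j < n \<Longrightarrow> q (\<sigma> k) j \<le> v k j \<and> v k j \<le> q (\<sigma> k) j + 1"
      "\<And>k. f (G (Suc (\<sigma> k)) (u k)) i \<le> 0" "\<And>k. 0 \<le> f (G (Suc (\<sigma> k)) (v k)) i"
      by metis
    have c: "isCont (\<lambda>x. f x i) l"
      using cont[OF i] by (simp add: continuous_on_eq_continuous_at)
    have "(\<lambda>k. f (G (Suc (\<sigma> k)) (u k)) i) \<longlonglongrightarrow> f l i"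
      using isCont_tendsto_compose[OF c near[OF uv(1)]] .
    then have "f l i \<le> 0" using uv(3) by (intro LIMSEQ_le_const2) auto
    moreover have "(\<lambda>k. f (G (Suc (\<sigma> k)) (v k)) i) \<longlonglongrightarrow> f l i"
      using isCont_tendsto_compose[OF c near[OF uv(2)]] .
    then have "0 \<le> f l i" using uv(4) by (intro LIMSEQ_le_const) auto
    ultimately show ?thesis by simp
  qed
  then show thesis using l that by blast
qed

section \<open>Trajectories and their dependence on parameters\<close>

text \<open>Continuous induction: at the first time where \<open>g\<close> reaches \<open>a\<close>
  the weak bound has held so far, and \<open>step\<close> makes it strict, a contradiction. It turns
  estimates valid only while a trajectory stays in some region into unconditional ones.\<close>

lemma no_exit:
  fixes g :: "real \<Rightarrow> real"
  assumes cont: "continuous_on {0..T} g" and g0: "g 0 < a"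
    and step: "\<And>t. t \<in> {0..T} \<Longrightarrow> (\<And>s. s \<in> {0..t} \<Longrightarrow> g s \<le> a) \<Longrightarrow> g t < a"
    and t: "t \<in> {0..T}"
  shows "g t < a"
proof (rule ccontr)
  assume "\<not> g t < a"
  define A where "A = {0..T} \<inter> g -` {a..}"
  have "closed A"
    unfolding A_def by (intro continuous_closed_preimage cont) auto
  moreover have "bounded A" by (rule bounded_subset[of "{0..T}"]) (auto simp: A_def)
  moreover have "A \<noteq> {}" using t \<open>\<not> g t < a\<close> by (auto simp: A_def)
  ultimately obtain t0 where t0: "t0 \<in> A" "\<And>s. s \<in> A \<Longrightarrow> t0 \<le> s"
    using compact_attains_inf[of A] by (auto simp: compact_eq_bounded_closed)
  have t0T: "0 \<le> t0" "t0 \<le> T" "a \<le> g t0" using t0(1) by (auto simp: A_def)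
  obtain s where s: "0 \<le> s" "s \<le> t0" "g s = a"
    using IVT'[of g 0 a t0] g0 t0T continuous_on_subset[OF cont, of "{0..t0}"] by auto
  then have "s = t0" using t0(2)[of s] t0T by (auto simp: A_def)
  then have "g t0 = a" using s by simp
  have "g s \<le> a" if "s \<in> {0..t0}" for s
    using that t0(2)[of s] t0T \<open>g t0 = a\<close> by (cases "s = t0") (force simp: A_def)+
  then have "g t0 < a" using step[of t0] t0T by auto
  then show False using t0T by simp
qed

lemma has_vector_derivative_continuous_on_real:
  assumes "\<And>t. (z has_vector_derivative z' t) (at t)"
  shows "continuous_on S z"
  by (meson assms continuous_at_imp_continuous_on has_vector_derivative_continuous)

text \<open>Gronwall's argument for the squared distance, which is differentiable even where the
  trajectories meet. Only \<open>V\<close> is Lipschitz; \<open>W\<close> is merely uniformly close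
  to it. The margin 1 between \<open>R - 1\<close> and \<open>R\<close>, together with
  \<open>\<eta> \<le> 1\<close>, keeps \<open>w\<close> in the ball where the bounds hold.\<close>

lemma trajectory_stability:
  fixes V W :: "'a::real_inner \<Rightarrow> 'a"
  assumes z: "\<And>t. (z has_vector_derivative V (z t)) (at t)"
    and w: "\<And>t. (w has_vector_derivative W (w t)) (at t)" and "w 0 = z 0"
    and L: "L-lipschitz_on (cball 0 R) V" and \<delta>: "\<And>x. norm x \<le> R \<Longrightarrow> norm (W x - V x) \<le> \<delta>" "\<delta> \<ge> 0"
    and R: "\<And>t. t \<in> {0..T} \<Longrightarrow> norm (z t) \<le> R - 1"
    and \<eta>: "0 < \<eta>" "\<eta> \<le> 1" "\<delta>\<^sup>2 * T * exp ((2 * L + 1) * T) < \<eta>\<^sup>2"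
    and t: "t \<in> {0..T}"
  shows "norm (w t - z t) < \<eta>"
proof -
  have L0: "L \<ge> 0" using L by (rule lipschitz_on_nonneg)
  define d where "d = (\<lambda>t. (w t - z t) \<bullet> (w t - z t))"
  have d_eq: "d s = (norm (w s - z s))\<^sup>2" for s by (simp add: d_def power2_norm_eq_inner)
  have d': "(d has_real_derivative 2 * ((w s - z s) \<bullet> (W (w s) - V (z s)))) (at s)" for s
    unfolding d_def has_real_derivative_iff_has_vector_derivative
    by (rule has_vector_derivative_eq_rhs[OF bounded_bilinear.has_vector_derivative[OF bounded_bilinear_inner]])
       (auto intro!: derivative_intros z w simp: inner_commute)
  have "d t < \<eta>\<^sup>2"
  proof (rule no_exit[where T = T and g = d])
    show "continuous_on {0..T} d"
      by (meson DERIV_isCont continuous_at_imp_continuous_on d')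
    show "d 0 < \<eta>\<^sup>2" using \<open>w 0 = z 0\<close> \<eta> by (simp add: d_def)
    show "d t < \<eta>\<^sup>2" if t: "t \<in> {0..T}" and le: "\<And>s. s \<in> {0..t} \<Longrightarrow> d s \<le> \<eta>\<^sup>2" for t
    proof -
    \<comment> \<open>The exponent \<open>2 * L + 1\<close> collects 2L from the Lipschitz term and
      1 from splitting 2 \<delta> |w - z| into \<delta>^2 + |w - z|^2; the subtracted linear term
      absorbs \<delta>^2.\<close>
    define h where "h = (\<lambda>s. d s * exp (- ((2 * L + 1) * s)) - \<delta>\<^sup>2 * s)"
    have "h t \<le> h 0"
    proof (rule DERIV_nonpos_imp_nonincreasing[of 0 t h])
      show "0 \<le> t" using t by simp
      fix s assume s: "0 \<le> s" "s \<le> t"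
      let ?n = "norm (w s - z s)"
      have n1: "?n \<le> 1"
        using power2_le_imp_le[of ?n \<eta>] le[of s] s \<eta> by (simp add: d_eq)
      have zR: "norm (z s) \<le> R - 1" using R[of s] s t by auto
      have wR: "norm (w s) \<le> R"
        using norm_triangle_ineq[of "w s - z s" "z s"] n1 zR by simp
      have "norm (V (w s) - V (z s)) \<le> L * ?n"
        using lipschitz_onD[OF L, of "w s" "z s"] wR zR by (simp add: dist_norm)
      then have "norm (W (w s) - V (z s)) \<le> \<delta> + L * ?n"
        using \<delta>(1)[OF wR] norm_triangle_ineq[of "W (w s) - V (w s)" "V (w s) - V (z s)"] by simp
      then have "(w s - z s) \<bullet> (W (w s) - V (z s)) \<le> ?n * (\<delta> + L * ?n)"
        by (meson norm_cauchy_schwarz mult_left_mono norm_ge_zero order_trans)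
      then have "2 * ((w s - z s) \<bullet> (W (w s) - V (z s))) \<le> (2 * L) * ?n\<^sup>2 + 2 * \<delta> * ?n"
        by (simp add: algebra_simps power2_eq_square)
      also have "2 * \<delta> * ?n \<le> \<delta>\<^sup>2 + ?n\<^sup>2"
        using sum_squares_bound[of \<delta> ?n] by simp
      finally have 1: "2 * ((w s - z s) \<bullet> (W (w s) - V (z s))) - (2 * L + 1) * d s \<le> \<delta>\<^sup>2"
        by (simp add: d_eq algebra_simps)
      have "(2 * ((w s - z s) \<bullet> (W (w s) - V (z s))) - (2 * L + 1) * d s) * exp (- ((2 * L + 1) * s)) \<le> \<delta>\<^sup>2 * 1"
        by (rule mult_mono[OF 1]) (use L0 s in auto)
      moreover have "(h has_real_derivative
          (2 * ((w s - z s) \<bullet> (W (w s) - V (z s))) - (2 * L + 1) * d s) * exp (- ((2 * L + 1) * s)) - \<delta>\<^sup>2) (at s)"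
        unfolding h_def
        by (auto intro!: derivative_eq_intros d' simp: algebra_simps)
      ultimately show "\<exists>y. (h has_real_derivative y) (at s) \<and> y \<le> 0"
        by (intro exI conjI) auto
    qed
    also have "h 0 = 0" using \<open>w 0 = z 0\<close> by (simp add: h_def d_def)
    finally have "d t * exp (- ((2 * L + 1) * t)) \<le> \<delta>\<^sup>2 * t" by (simp add: h_def)
    from mult_right_mono[OF this, of "exp ((2 * L + 1) * t)"]
    have "d t \<le> \<delta>\<^sup>2 * t * exp ((2 * L + 1) * t)"
      by (simp add: mult.assoc exp_add[symmetric])
    also have "\<dots> \<le> \<delta>\<^sup>2 * T * exp ((2 * L + 1) * T)"
      using t L0 by (intro mult_mono) auto
    finally show ?thesis using \<eta>(3) by simp
    qed
  qed (use t in auto)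
  then show ?thesis
    using \<eta>(1) unfolding d_eq by (rule power_less_imp_less_base[OF _ less_imp_le])
qed

lemma locally_lipschitz_lipschitz_on_cball:
  fixes V :: "'a::euclidean_space \<Rightarrow> 'b::metric_space"
  assumes "locally_lipschitz V"
  obtains L where "L-lipschitz_on (cball 0 R) V"
proof -
  have "local_lipschitz {0::real} (cball 0 R) (\<lambda>_. V)"
    using assms unfolding locally_lipschitz_def by (rule local_lipschitz_subset) auto
  then show thesis
    using local_lipschitz_compact_implies_lipschitz[where T = "{0::real}" and X = "cball 0 R" and f = "\<lambda>_. V"] that by auto
qed

lemma trajectory_bounded:
  assumes "\<And>t. (z has_vector_derivative z' t) (at t)"
  obtains R where "\<And>t. t \<in> {0..T} \<Longrightarrow> norm (z t) \<le> R - 1"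
proof -
  have "bounded (z ` {0..T})"
    by (intro compact_imp_bounded compact_continuous_image has_vector_derivative_continuous_on_real[OF assms]) auto
  then obtain B where "\<And>t. t \<in> {0..T} \<Longrightarrow> norm (z t) \<le> B"
    by (force simp: bounded_iff)
  then show thesis using that[of "B + 1"] by simp
qed

text \<open>The hypothesis is Lipschitz continuity on balls because the lemma is applied both to a
  field and to its negative.\<close>

lemma forward_unique:
  fixes V :: "'a::euclidean_space \<Rightarrow> 'a"
  assumes lip: "\<And>R. \<exists>L. L-lipschitz_on (cball 0 R) V"
    and z: "\<And>t. (z has_vector_derivative V (z t)) (at t)"
    and w: "\<And>t. (w has_vector_derivative V (w t)) (at t)" and "w 0 = z 0" and t: "t \<ge> 0"
  shows "w t = z t"
proof (rule ccontr)
  assume "w t \<noteq> z t"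
  \<comment> \<open>Stability with \<delta> = 0 holds for every admissible \<eta>; taking the
    distance itself, capped at 1, is contradictory.\<close>
  define \<eta> where "\<eta> = min 1 (norm (w t - z t))"
  obtain R where R: "\<And>s. s \<in> {0..t} \<Longrightarrow> norm (z s) \<le> R - 1"
    using trajectory_bounded[OF z, of t] by blast
  obtain L where "L-lipschitz_on (cball 0 R) V" using lip by blast
  then have "norm (w t - z t) < \<eta>"
    by (rule trajectory_stability[where \<delta> = 0 and T = t, OF z w \<open>w 0 = z 0\<close>])
       (use R t \<open>w t \<noteq> z t\<close> in \<open>auto simp: \<eta>_def min_def\<close>)
  then show False by (simp add: \<eta>_def)
qed

text \<open>\<open>flow\<close> is a definite description over solutions on the whole line, so
  uniqueness must cover negative times too; these follow by reversing time.\<close>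

lemma trajectory_unique:
  fixes V :: "'a::euclidean_space \<Rightarrow> 'a"
  assumes V: "locally_lipschitz V" and z: "is_trajectory V x z" and w: "is_trajectory V x w"
  shows "w = z"
proof
  fix t
  have lip: "\<exists>L. L-lipschitz_on (cball 0 R) V" for R
    using locally_lipschitz_lipschitz_on_cball[OF V] by metis
  have lip': "\<exists>L. L-lipschitz_on (cball 0 R) (\<lambda>x. - V x)" for R
    using lip[of R] by (auto simp: lipschitz_on_def dist_minus)
  have rev: "((\<lambda>s. y (- s)) has_vector_derivative - V (y (- s))) (at s)" if "is_trajectory V x y" for y s
  proof -
    have "(y \<circ> uminus has_vector_derivative (- 1) *\<^sub>R V (y (- s))) (at s)"
      by (rule vector_diff_chain_at) (use that in \<open>auto simp: is_trajectory_def intro!: derivative_eq_intros\<close>)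
    then show ?thesis by (simp add: o_def)
  qed
  show "w t = z t"
  proof (cases "t \<ge> 0")
    case True
    then show ?thesis
      using forward_unique[OF lip, of z w t] z w by (auto simp: is_trajectory_def)
  next
    case False
    then show ?thesis
      using forward_unique[OF lip' rev[OF z] rev[OF w], of "- t"] z w by (auto simp: is_trajectory_def)
  qed
qed

lemma is_trajectory_flow:
  fixes V :: "'a::euclidean_space \<Rightarrow> 'a"
  assumes V: "locally_lipschitz V" "generates_global_flow V"
  shows "is_trajectory V x (\<lambda>t. flow V t x)"
proof -
  obtain z where z: "is_trajectory V x z"
    using V(2) by (auto simp: generates_global_flow_def)
  then have "(THE z. is_trajectory V x z) = z"
    using trajectory_unique[OF V(1) z] by blast
  then show ?thesis using z by (simp add: flow_def)
qed

text \<open>Stability around the trajectory at the fixed parameter \<open>q\<close>: its field alone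
  supplies the Lipschitz constant, and the distance of the fields on a ball tends to 0 with
  \<open>p\<close>. Parameters are functions with the product topology, and only the first
  \<open>n\<close> coordinates enter.\<close>

lemma continuous_on_flow_parameter:
  fixes V\<^sub>0 :: "'a::euclidean_space \<Rightarrow> 'a" and V :: "nat \<Rightarrow> 'a \<Rightarrow> 'a" and n :: nat
  defines "comb \<equiv> \<lambda>p x. V\<^sub>0 x + (\<Sum>j<n. p j *\<^sub>R V j x)"
  assumes V: "\<And>p. locally_lipschitz (comb p)" "\<And>p. generates_global_flow (comb p)"
    and Vj: "\<And>j. j < n \<Longrightarrow> continuous_on UNIV (V j)" and T: "T \<ge> 0"
  shows "continuous_on UNIV (\<lambda>p. flow (comb p) T x)"
proof -
  have "((\<lambda>p. flow (comb p) T x) \<longlongrightarrow> flow (comb q) T x) (at q)" for q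
  proof (rule tendstoI)
    fix e :: real assume e: "e > 0"
    define \<eta> where "\<eta> = min e 1"
    have traj: "(flow (comb p) 0 x = x) \<and>
        (\<forall>t. ((\<lambda>t. flow (comb p) t x) has_vector_derivative comb p (flow (comb p) t x)) (at t))" for p
      using is_trajectory_flow[OF V, of p x] by (simp add: is_trajectory_def)
    obtain R where R: "\<And>t. t \<in> {0..T} \<Longrightarrow> norm (flow (comb q) t x) \<le> R - 1"
      using trajectory_bounded[OF traj[THEN conjunct2, rule_format, of q]] by blast
    obtain L where L: "L-lipschitz_on (cball 0 R) (comb q)"
      using locally_lipschitz_lipschitz_on_cball[OF V(1)] .
    have "\<exists>B. \<forall>y\<in>cball 0 R. norm (V j y) \<le> B" if "j < n" for j
    proof -
      have "bounded (V j ` cball 0 R)"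
        by (intro compact_imp_bounded compact_continuous_image continuous_on_subset[OF Vj[OF that]]) auto
      then show ?thesis by (auto simp: bounded_iff)
    qed
    then obtain B where B: "\<And>j y. j < n \<Longrightarrow> norm y \<le> R \<Longrightarrow> norm (V j y) \<le> B j"
      by (metis mem_cball_0)
    define \<delta> where "\<delta> p = (\<Sum>j<n. \<bar>p j - q j\<bar> * \<bar>B j\<bar>)" for p
    have "\<delta> \<midarrow>q\<rightarrow> (\<Sum>j<n. \<bar>q j - q j\<bar> * \<bar>B j\<bar>)"
      unfolding \<delta>_def
      by (intro tendsto_intros) (use tendsto_fun_iff[of "\<lambda>p. p" q "at q"] in auto)
    then have "\<delta> \<midarrow>q\<rightarrow> 0" by simp
    then have "(\<lambda>p. (\<delta> p)\<^sup>2 * T * exp ((2 * L + 1) * T)) \<midarrow>q\<rightarrow> 0\<^sup>2 * T * exp ((2 * L + 1) * T)"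
      by (intro tendsto_intros)
    moreover have "0\<^sup>2 * T * exp ((2 * L + 1) * T) < \<eta>\<^sup>2" using e by (simp add: \<eta>_def)
    ultimately have "\<forall>\<^sub>F p in at q. (\<delta> p)\<^sup>2 * T * exp ((2 * L + 1) * T) < \<eta>\<^sup>2"
      by (rule order_tendstoD)
    then show "\<forall>\<^sub>F p in at q. dist (flow (comb p) T x) (flow (comb q) T x) < e"
    proof eventually_elim
      case (elim p)
      have "norm (comb p y - comb q y) \<le> \<delta> p" if y: "norm y \<le> R" for y
      proof -
        have "comb p y - comb q y = (\<Sum>j<n. (p j - q j) *\<^sub>R V j y)"
          by (simp add: comb_def sum_subtractf scaleR_diff_left)
        also have "norm \<dots> \<le> (\<Sum>j<n. norm ((p j - q j) *\<^sub>R V j y))" by (rule norm_sum)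
        also have "\<dots> \<le> \<delta> p"
          unfolding \<delta>_def
          by (rule sum_mono) (use B y in \<open>auto intro!: mult_left_mono intro: order_trans[OF _ abs_ge_self]\<close>)
        finally show ?thesis .
      qed
      then have "norm (flow (comb p) T x - flow (comb q) T x) < \<eta>"
        using traj e elim R T
        by (intro trajectory_stability[where \<delta> = "\<delta> p" and T = T and W = "comb p", OF _ _ _ L])
           (auto simp: \<eta>_def \<delta>_def intro!: sum_nonneg)
      then show ?case by (simp add: dist_norm \<eta>_def)
    qed
  qed
  then show ?thesis by (simp add: continuous_on_def)
qed

text \<open>The speed bound is assumed only within distance \<open>r\<close> of the start, but at
  speed \<open>C\<close> the time \<open>T\<close> is too short to cover \<open>r\<close>, so the
  trajectory never leaves this region.\<close>

lemma displacement_small: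
  assumes y: "\<And>t. (y has_vector_derivative Y t) (at t)"
    and C: "\<And>t. t \<in> {0..T} \<Longrightarrow> norm (y t - y 0) \<le> r \<Longrightarrow> norm (Y t) \<le> C"
    and r: "T * C < r" "0 \<le> C" "0 \<le> T" and t: "t \<in> {0..T}"
  shows "norm (y t - y 0) \<le> T * C"
proof -
  have bound: "norm (y t - y 0) \<le> T * C"
    if t: "t \<in> {0..T}" and le: "\<And>s. s \<in> {0..t} \<Longrightarrow> norm (y s - y 0) \<le> r" for t
  proof -
    have "norm (y t - y 0) \<le> C * norm (t - 0)"
    proof (rule differentiable_bound[where S = "{0..t}" and f' = "\<lambda>s h. h *\<^sub>R Y s"])
      show "(y has_derivative (\<lambda>h. h *\<^sub>R Y s)) (at s within {0..t})" for s
        using y[of s] by (auto simp: has_vector_derivative_def intro: has_derivative_at_withinI)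
      show "onorm (\<lambda>h. h *\<^sub>R Y s) \<le> C" if "s \<in> {0..t}" for s
        using C[of s] le[of s] that t
        by (intro onorm_bound) (auto simp: mult.commute[of C] intro: mult_left_mono r)
    qed (use t in auto)
    also have "\<dots> \<le> T * C" using t r by (auto simp: mult.commute intro!: mult_left_mono)
    finally show ?thesis .
  qed
  have "norm (y t - y 0) < r" if "t \<in> {0..T}" for t
  proof (rule no_exit[where T = T and g = "\<lambda>t. norm (y t - y 0)"])
    show "continuous_on {0..T} (\<lambda>t. norm (y t - y 0))"
      by (intro continuous_intros has_vector_derivative_continuous_on_real[OF y])
    show "norm (y 0 - y 0) < r" using r by (simp add: le_less_trans[OF mult_nonneg_nonneg])
  qed (use bound r that in \<open>auto intro: le_less_trans\<close>)
  then show ?thesis using t by (intro bound[OF t] less_imp_le) auto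
qed

section \<open>Interpolation by diffeomorphisms\<close>

text \<open>\<open>E x\<close> inverts the differential \<open>D x\<close> from the right, so that
  \<open>E x (W (\<psi> x))\<close> is the pullback of a field \<open>W\<close>. The continuous left
  inverse \<open>\<phi>\<close> makes \<open>\<psi>\<close> injective and carries balls back to
  compact sets. Joint continuity in point and vector replaces an operator norm.\<close>

definition C1_diffeo ::
  "('a::euclidean_space \<Rightarrow> 'a) \<Rightarrow> ('a \<Rightarrow> 'a) \<Rightarrow> ('a \<Rightarrow> 'a \<Rightarrow> 'a) \<Rightarrow> ('a \<Rightarrow> 'a \<Rightarrow> 'a) \<Rightarrow> bool" where
  "C1_diffeo \<psi> \<phi> D E \<longleftrightarrow>
     (\<forall>x. (\<psi> has_derivative D x) (at x)) \<and> continuous_on UNIV \<phi> \<and> (\<forall>x. \<phi> (\<psi> x) = x) \<and>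
     continuous_on UNIV (\<lambda>(x, v). D x v) \<and> continuous_on UNIV (\<lambda>(x, v). E x v) \<and>
     (\<forall>x v. D x (E x v) = v)"

lemma C1_diffeo_compose:
  assumes 1: "C1_diffeo \<psi>1 \<phi>1 D1 E1" and 2: "C1_diffeo \<psi>2 \<phi>2 D2 E2"
  shows "C1_diffeo (\<lambda>x. \<psi>2 (\<psi>1 x)) (\<lambda>y. \<phi>1 (\<phi>2 y)) (\<lambda>x v. D2 (\<psi>1 x) (D1 x v)) (\<lambda>x v. E1 x (E2 (\<psi>1 x) v))"
proof -
  have \<psi>1: "continuous_on UNIV \<psi>1"
    using 1 unfolding C1_diffeo_def by (meson continuous_at_imp_continuous_on has_derivative_continuous)
  have fst: "continuous_on UNIV (\<lambda>z::'a \<times> 'a. \<psi>1 (fst z))"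
    by (rule continuous_on_compose2[OF \<psi>1]) (auto intro: continuous_intros)
  have pair: "continuous_on UNIV (\<lambda>z::'a \<times> 'a. F (f z) (g z))"
    if "continuous_on UNIV (\<lambda>(x, v). F x v)" "continuous_on UNIV f" "continuous_on UNIV g"
    for F :: "'a \<Rightarrow> 'a \<Rightarrow> 'a" and f g
    using continuous_on_compose2[OF that(1), of UNIV "\<lambda>z. (f z, g z)"] that(2,3)
    by (auto intro: continuous_intros)
  have cont: "continuous_on UNIV (\<lambda>(x, v). D1 x v)" "continuous_on UNIV (\<lambda>(x, v). D2 x v)"
    "continuous_on UNIV (\<lambda>(x, v). E1 x v)" "continuous_on UNIV (\<lambda>(x, v). E2 x v)"
    using 1 2 by (simp_all add: C1_diffeo_def)
  have "continuous_on UNIV (\<lambda>z. D2 (\<psi>1 (fst z)) (D1 (fst z) (snd z)))"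
    by (rule pair[OF cont(2) fst]) (use cont(1) in \<open>simp add: case_prod_unfold\<close>)
  moreover have "continuous_on UNIV (\<lambda>z. E2 (\<psi>1 (fst z)) (snd z))"
    by (rule pair[OF cont(4) fst]) (intro continuous_intros)
  then have "continuous_on UNIV (\<lambda>z. E1 (fst z) (E2 (\<psi>1 (fst z)) (snd z)))"
    by (rule pair[OF cont(3) continuous_on_fst[OF continuous_on_id]])
  moreover have "continuous_on UNIV (\<lambda>y. \<phi>1 (\<phi>2 y))"
    using 1 2 by (intro continuous_on_compose2[of UNIV \<phi>1 UNIV \<phi>2]) (auto simp: C1_diffeo_def)
  moreover have "((\<lambda>x. \<psi>2 (\<psi>1 x)) has_derivative (\<lambda>v. D2 (\<psi>1 x) (D1 x v))) (at x)" for x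
    using 1 2 has_derivative_compose[of \<psi>1 "D1 x" x UNIV \<psi>2 "D2 (\<psi>1 x)"] unfolding C1_diffeo_def by simp
  ultimately show ?thesis
    using 1 2 unfolding C1_diffeo_def by (simp add: case_prod_unfold)
qed

lemma C1_diffeo_derivative_bounded:
  assumes "C1_diffeo \<psi> \<phi> D E" "compact K"
  obtains B where "B > 0" "\<And>x v. x \<in> K \<Longrightarrow> norm (D x v) \<le> B * norm v"
proof -
  have lin: "linear (D x)" for x
    using assms(1) unfolding C1_diffeo_def by (meson bounded_linear.linear has_derivative_bounded_linear)
  have "bounded ((\<lambda>(x, v). D x v) ` (K \<times> cball 0 1))"
    using assms unfolding C1_diffeo_def
    by (intro compact_imp_bounded compact_continuous_image compact_Times)
       (auto intro: continuous_on_subset)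
  then obtain B where B: "B > 0" "\<And>y. y \<in> (\<lambda>(x, v). D x v) ` (K \<times> cball 0 1) \<Longrightarrow> norm y \<le> B"
    unfolding bounded_pos by blast
  have "norm (D x v) \<le> B * norm v" if "x \<in> K" for x v
  proof (cases "v = 0")
    case True
    then show ?thesis using lin by (simp add: linear_0)
  next
    case False
    have "norm (D x (v /\<^sub>R norm v)) \<le> B"
      using that False by (intro B(2)) auto
    then show ?thesis
      using False by (simp add: linear_scale[OF lin] field_simps)
  qed
  then show thesis using B(1) that by blast
qed

section \<open>Interpolation by polynomial shears\<close>

lemma lagrange_basis:
  fixes A :: "real set"
  assumes "finite A" "x\<^sub>0 \<in> A"
  obtains p where "poly p x\<^sub>0 = 1" "\<And>x. x \<in> A \<Longrightarrow> x \<noteq> x\<^sub>0 \<Longrightarrow> poly p x = 0"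
proof
  let ?p = "\<Prod>y\<in>A - {x\<^sub>0}. smult (1 / (x\<^sub>0 - y)) [:- y, 1:]"
  show "poly ?p x\<^sub>0 = 1"
    unfolding poly_prod by (rule prod.neutral) (auto simp: diff_divide_distrib[symmetric])
  show "poly ?p x = 0" if "x \<in> A" "x \<noteq> x\<^sub>0" for x
    unfolding poly_prod by (rule prod_zero) (use assms that in auto)
qed

text \<open>The map x + G(b . x) with G orthogonal to b leaves b . x unchanged. Hence subtracting
  the same G inverts it, and changing the sign of the rank-one term inverts its differential.
  Lagrange interpolation chooses G.\<close>

lemma shear_interpolation:
  fixes P v :: "'i \<Rightarrow> 'a::euclidean_space"
  assumes S: "finite S" and inj: "inj_on (\<lambda>s. b \<bullet> P s) S" and bv: "\<And>s. s \<in> S \<Longrightarrow> b \<bullet> v s = 0"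
  obtains \<psi> \<phi> D E where "C1_diffeo \<psi> \<phi> D E" "\<And>s. s \<in> S \<Longrightarrow> \<psi> (P s) = P s + v s"
proof -
  have "\<exists>p. poly p (b \<bullet> P s) = 1 \<and> (\<forall>s'\<in>S. s' \<noteq> s \<longrightarrow> poly p (b \<bullet> P s') = 0)" if s: "s \<in> S" for s
  proof -
    obtain p where "poly p (b \<bullet> P s) = 1"
      "\<And>x. x \<in> (\<lambda>s. b \<bullet> P s) ` S \<Longrightarrow> x \<noteq> b \<bullet> P s \<Longrightarrow> poly p x = 0"
      by (rule lagrange_basis[of "(\<lambda>s. b \<bullet> P s) ` S" "b \<bullet> P s"]) (use S s in auto)
    with s inj show ?thesis
      by (intro exI[of _ p]) (auto dest: inj_onD)
  qed
  then obtain p where p: "\<And>s. s \<in> S \<Longrightarrow> poly (p s) (b \<bullet> P s) = 1"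
    "\<And>s s'. s \<in> S \<Longrightarrow> s' \<in> S \<Longrightarrow> s' \<noteq> s \<Longrightarrow> poly (p s) (b \<bullet> P s') = 0"
    by metis
  define G where "G t = (\<Sum>s\<in>S. poly (p s) t *\<^sub>R v s)" for t
  define G' where "G' t = (\<Sum>s\<in>S. poly (pderiv (p s)) t *\<^sub>R v s)" for t
  have bG: "b \<bullet> G t = 0" "b \<bullet> G' t = 0" for t
    unfolding G_def G'_def inner_sum_right by (auto intro!: sum.neutral simp: bv)
  have cG': "continuous_on A G'" for A
    unfolding G'_def by (intro continuous_intros)
  have cG: "continuous_on A G" for A
    unfolding G_def by (intro continuous_intros)
  have G: "(G has_vector_derivative G' t) (at t)" for t
    unfolding G_def G'_def
    by (intro has_vector_derivative_sum has_vector_derivative_scaleR[OF poly_DERIV has_vector_derivative_const, THEN has_vector_derivative_eq_rhs])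
       auto
  show thesis
  proof
    have "((\<lambda>x. x + G (b \<bullet> x)) has_derivative (\<lambda>v. v + (b \<bullet> v) *\<^sub>R G' (b \<bullet> x))) (at x)" for x
    proof -
      have "((\<lambda>x. G (b \<bullet> x)) has_derivative (\<lambda>v. (b \<bullet> v) *\<^sub>R G' (b \<bullet> x))) (at x)"
        by (rule has_derivative_compose[of "\<lambda>x. b \<bullet> x" "\<lambda>v. b \<bullet> v" x UNIV G "\<lambda>h. h *\<^sub>R G' (b \<bullet> x)"])
           (use G[of "b \<bullet> x"] in \<open>auto simp: has_vector_derivative_def intro!: derivative_eq_intros\<close>)
      then show ?thesis by (intro derivative_intros)
    qed
    moreover have "continuous_on UNIV (\<lambda>y. y - G (b \<bullet> y))"
      by (intro continuous_intros continuous_on_compose2[OF cG[of UNIV]]) auto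
    ultimately show "C1_diffeo (\<lambda>x. x + G (b \<bullet> x)) (\<lambda>y. y - G (b \<bullet> y))
        (\<lambda>x v. v + (b \<bullet> v) *\<^sub>R G' (b \<bullet> x)) (\<lambda>x v. v - (b \<bullet> v) *\<^sub>R G' (b \<bullet> x))"
      unfolding C1_diffeo_def case_prod_unfold
      by (auto simp: inner_add_right inner_diff_right bG intro!: continuous_intros
          continuous_on_compose2[OF cG'[of UNIV]])
    fix s assume s: "s \<in> S"
    have "G (b \<bullet> P s) = (\<Sum>s'\<in>S. if s' = s then v s else 0)"
      unfolding G_def by (rule sum.cong) (use p s in auto)
    then show "P s + G (b \<bullet> P s) = P s + v s"
      using S s by simp
  qed
qed

text \<open>Finitely many hyperplanes are negligible and cannot cover the space.\<close>

lemma generic_vector: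
  fixes W :: "'a::euclidean_space set"
  assumes "finite W" "0 \<notin> W"
  obtains a where "\<And>w. w \<in> W \<Longrightarrow> w \<bullet> a \<noteq> 0"
proof -
  have "negligible (\<Union>w\<in>W. {x. w \<bullet> x = 0})"
    using assms by (intro negligible_Union) (auto intro!: negligible_hyperplane)
  then have "(\<Union>w\<in>W. {x. w \<bullet> x = 0}) \<noteq> UNIV"
    using non_negligible_UNIV by metis
  then show thesis using that by blast
qed

text \<open>The first shear corrects the coordinate along a generic \<open>b\<close>; the second moves every point
  within its hyperplane orthogonal to \<open>b\<close>, these hyperplanes being distinct.\<close>

lemma C1_diffeo_transitive:
  fixes P Q :: "'i \<Rightarrow> 'a::euclidean_space"
  assumes dim: "DIM('a) \<ge> 2" and S: "finite S" and P: "inj_on P S" and Q: "inj_on Q S"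
  obtains \<psi> \<phi> D E where "C1_diffeo \<psi> \<phi> D E" "\<And>s. s \<in> S \<Longrightarrow> \<psi> (P s) = Q s"
proof -
  define \<Delta> where "\<Delta> X = (\<lambda>(s, s'). X s - X s') ` {(s, s'). s \<in> S \<and> s' \<in> S \<and> s \<noteq> s'}" for X :: "'i \<Rightarrow> 'a"
  have fin: "finite (\<Delta> X)" for X
    unfolding \<Delta>_def by (rule finite_imageI, rule finite_subset[of _ "S \<times> S"]) (use S in auto)
  have nz: "0 \<notin> \<Delta> X" if "inj_on X S" for X
  proof
    assume "0 \<in> \<Delta> X"
    then obtain s s' where "s \<in> S" "s' \<in> S" "s \<noteq> s'" "0 = X s - X s'"
      unfolding \<Delta>_def by clarify
    with that show False by (simp add: inj_on_eq_iff)
  qed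
  have inj: "inj_on (\<lambda>s. h \<bullet> X s) S" if "\<And>w. w \<in> \<Delta> X \<Longrightarrow> w \<bullet> h \<noteq> 0" for X h
  proof (rule inj_onI, rule ccontr)
    fix s s' assume "s \<in> S" "s' \<in> S" "h \<bullet> X s = h \<bullet> X s'" "s \<noteq> s'"
    then have "(X s - X s') \<bullet> h = 0"
      by (simp add: inner_diff_right inner_commute[of _ h])
    moreover have "X s - X s' \<in> \<Delta> X"
      unfolding \<Delta>_def using \<open>s \<in> S\<close> \<open>s' \<in> S\<close> \<open>s \<noteq> s'\<close> by (intro image_eqI[of _ _ "(s, s')"]) auto
    ultimately show False using that by blast
  qed
  obtain e :: 'a where e: "e \<noteq> 0" using nonzero_Basis nonempty_Basis by blast
  \<comment> \<open>The extra vector \<open>e\<close> forces \<open>b \<noteq> 0\<close> even if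
    \<open>S\<close> has at most one point.\<close>
  obtain b where b: "\<And>w. w \<in> insert e (\<Delta> Q) \<Longrightarrow> w \<bullet> b \<noteq> 0"
    using generic_vector[of "insert e (\<Delta> Q)"] fin nz[OF Q] e by auto
  have b0: "b \<noteq> 0" using b[of e] by auto
  obtain d where d: "d \<noteq> 0" "orthogonal b d"
    using orthogonal_to_vector_exists[OF dim] by metis
  \<comment> \<open>Since \<open>d\<close> is orthogonal to \<open>b\<close> but not to
    \<open>a\<close>, the vector \<open>b\<close> is not a multiple of \<open>a\<close>. Such a
    \<open>d\<close> exists because the dimension is at least 2.\<close>
  obtain a where a: "\<And>w. w \<in> insert d (\<Delta> P) \<Longrightarrow> w \<bullet> a \<noteq> 0"
    using generic_vector[of "insert d (\<Delta> P)"] fin nz[OF P] d(1) by auto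
  \<comment> \<open>The component of \<open>b\<close> orthogonal to \<open>a\<close>: moving along
    it keeps the \<open>a\<close>-coordinate and changes the \<open>b\<close>-coordinate.\<close>
  define c where "c = b - ((a \<bullet> b) / (a \<bullet> a)) *\<^sub>R a"
  have da: "d \<bullet> a \<noteq> 0" using a by simp
  then have "a \<noteq> 0" by auto
  then have ac: "a \<bullet> c = 0" by (simp add: c_def inner_diff_right)
  have bc: "b \<bullet> c \<noteq> 0"
  proof
    assume "b \<bullet> c = 0"
    then have "c \<bullet> c = 0"
      using ac by (subst c_def) (simp add: inner_diff_left)
    then have *: "b = ((a \<bullet> b) / (a \<bullet> a)) *\<^sub>R a" by (simp add: c_def)
    have "d \<bullet> b = ((a \<bullet> b) / (a \<bullet> a)) * (d \<bullet> a)" by (subst * ) simp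
    then have "(a \<bullet> b) / (a \<bullet> a) = 0" using d da by (simp add: orthogonal_def inner_commute)
    with * b0 show False by (metis scaleR_zero_left)
  qed
  have injP: "inj_on (\<lambda>s. a \<bullet> P s) S"
    using a by (intro inj) auto
  have injQ: "inj_on (\<lambda>s. b \<bullet> Q s) S"
    using b by (intro inj) auto
  \<comment> \<open>Intermediate positions: \<open>P s\<close> moved along \<open>c\<close> until
    its \<open>b\<close>-coordinate is that of \<open>Q s\<close>.\<close>
  define R where "R s = P s + ((b \<bullet> Q s - b \<bullet> P s) / (b \<bullet> c)) *\<^sub>R c" for s
  have bR: "b \<bullet> R s = b \<bullet> Q s" for s
    using bc by (simp add: R_def inner_add_right)
  have "a \<bullet> (R s - P s) = 0" for s
    using ac by (simp add: R_def)
  then obtain \<psi>1 \<phi>1 D1 E1 where 1: "C1_diffeo \<psi>1 \<phi>1 D1 E1"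
    "\<And>s. s \<in> S \<Longrightarrow> \<psi>1 (P s) = P s + (R s - P s)"
    using shear_interpolation[OF S injP, of "\<lambda>s. R s - P s"] by blast
  have "inj_on (\<lambda>s. b \<bullet> R s) S" using injQ by (simp add: bR)
  moreover have "b \<bullet> (Q s - R s) = 0" for s
    using bR by (simp add: inner_diff_right)
  ultimately obtain \<psi>2 \<phi>2 D2 E2 where 2: "C1_diffeo \<psi>2 \<phi>2 D2 E2"
    "\<And>s. s \<in> S \<Longrightarrow> \<psi>2 (R s) = R s + (Q s - R s)"
    using shear_interpolation[OF S, of b R "\<lambda>s. Q s - R s"] by blast
  show thesis
    by (rule that[OF C1_diffeo_compose[OF 1(1) 2(1)]]) (simp add: 1(2) 2(2))
qed

section \<open>Permutations of finite sets\<close>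

text \<open>Congruence modulo the cycle length is written with an integer witness because the
  multiple later counts full turns of a rotation.\<close>

lemma funpow_eq_imp_dvd:
  assumes "permutation \<sigma>" "(\<sigma> ^^ m) x = (\<sigma> ^^ n) x"
  shows "\<exists>l::int. int m = int n + l * int (least_power \<sigma> x)"
proof -
  have *: "\<exists>l::int. int n = int m + l * int (least_power \<sigma> x)"
    if "m \<le> n" "(\<sigma> ^^ m) x = (\<sigma> ^^ n) x" for m n
  proof -
    have "(\<sigma> ^^ (n - m)) x = x"
      using funpow_diff[of \<sigma> m n x] that permutation_bijective[OF assms(1)] by (auto simp: bij_is_inj)
    then obtain l where "n - m = least_power \<sigma> x * l"
      using least_power_minimal by (metis dvdE)
    with that(1) have "int n = int m + int l * int (least_power \<sigma> x)"
      by (metis le_add_diff_inverse mult.commute of_nat_add of_nat_mult)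
    then show ?thesis by blast
  qed
  show ?thesis
  proof (cases "m \<le> n")
    case True
    then obtain l where "int n = int m + l * int (least_power \<sigma> x)" using *[of m n] assms by auto
    then show ?thesis by (intro exI[of _ "- l"]) simp
  next
    case False
    then show ?thesis using *[of n m] assms by auto
  qed
qed

lemma dvd_imp_funpow_eq:
  assumes "permutation \<sigma>" "int m = int n + l * int (least_power \<sigma> x)"
  shows "(\<sigma> ^^ m) x = (\<sigma> ^^ n) x"
proof -
  have *: "(\<sigma> ^^ n) x = (\<sigma> ^^ m) x" if "m \<le> n" "int n = int m + l * int (least_power \<sigma> x)" for m n l
  proof -
    have "int (n - m) = l * int (least_power \<sigma> x)" using that by (simp add: of_nat_diff)
    then have "least_power \<sigma> x dvd n - m" by (metis dvd_triv_right int_dvd_int_iff)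
    then have "(\<sigma> ^^ (n - m)) x = x" using least_power_dvd[OF assms(1)] by blast
    moreover have "(\<sigma> ^^ n) x = (\<sigma> ^^ m) ((\<sigma> ^^ (n - m)) x)"
      using that(1) by (metis comp_apply funpow_add le_add_diff_inverse)
    ultimately show ?thesis by simp
  qed
  show ?thesis
  proof (cases "m \<le> n")
    case True
    then show ?thesis using *[of m n "- l"] assms by simp
  next
    case False
    then show ?thesis using *[of n m l] assms by simp
  qed
qed

text \<open>\<open>c\<close> numbers the cycle, \<open>k\<close> is its length, and \<open>j\<close> is the position on it modulo \<open>k\<close>.\<close>

lemma cycle_coordinates:
  assumes "finite S" "\<sigma> permutes S"
  obtains c k j :: "'a \<Rightarrow> nat" where
    "\<And>s. s \<in> S \<Longrightarrow> k s > 0"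
    "\<And>s. s \<in> S \<Longrightarrow> c (\<sigma> s) = c s"
    "\<And>s. s \<in> S \<Longrightarrow> \<exists>l::int. int (j (\<sigma> s)) = int (j s) + 1 + l * int (k s)"
    "\<And>s s'. s \<in> S \<Longrightarrow> s' \<in> S \<Longrightarrow> c s = c s' \<Longrightarrow> k s = k s'"
    "\<And>s s' l. s \<in> S \<Longrightarrow> s' \<in> S \<Longrightarrow> c s = c s' \<Longrightarrow> int (j s) = int (j s') + l * int (k s) \<Longrightarrow> s = s'"
proof -
  have perm: "permutation \<sigma>" using assms permutation_permutes by blast
  \<comment> \<open>Forward orbits suffice, since some iterate returns to the start.
    \<open>rep\<close> depends on \<open>s\<close> only through this set, hence is constant on a
    cycle.\<close>
  define orb where "orb s = range (\<lambda>i. (\<sigma> ^^ i) s)" for s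
  define rep where "rep s = (SOME x. x \<in> orb s)" for s
  have orb_sub: "orb x \<subseteq> orb s" if "x \<in> orb s" for x s
    using that by (auto simp: orb_def) (metis comp_apply funpow_add rangeI)
  have orb_sym: "s \<in> orb x" if mem: "x \<in> orb s" for x s
  proof -
    obtain i where i: "x = (\<sigma> ^^ i) s" using mem by (auto simp: orb_def)
    let ?k = "least_power \<sigma> s"
    \<comment> \<open>The number \<open>?k * i\<close> is a multiple of the cycle length and at
      least \<open>i\<close>; after the \<open>i\<close> steps already made, the rest closes the
      loop.\<close>
    have "?k > 0" using least_power_of_permutation[OF perm] by blast
    then have "i \<le> ?k * i" by simp
    then have "(\<sigma> ^^ (?k * i - i)) x = (\<sigma> ^^ (?k * i)) s"
      unfolding i by (metis comp_apply funpow_add le_add_diff_inverse2)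
    also have "\<dots> = s" using least_power_dvd[OF perm] by (metis dvd_triv_left)
    finally show ?thesis unfolding orb_def by (metis rangeI)
  qed
  have orb_eq: "orb x = orb s" if "x \<in> orb s" for x s
    using orb_sub[OF that] orb_sub[OF orb_sym[OF that]] by blast
  have self: "s \<in> orb s" for s unfolding orb_def by (metis funpow_0 rangeI)
  have rep_in: "rep s \<in> orb s" for s unfolding rep_def using self by (rule someI)
  have rep_\<sigma>: "rep (\<sigma> s) = rep s" for s
  proof -
    have "\<sigma> s \<in> orb s" unfolding orb_def by (rule image_eqI[of _ _ 1]) auto
    from orb_eq[OF this] show ?thesis by (simp add: rep_def)
  qed
  have S_orb: "orb s \<subseteq> S" if "s \<in> S" for s
  proof -
    have "(\<sigma> ^^ i) s \<in> S" for i
      by (induction i) (use that assms(2) in \<open>auto simp: permutes_in_image\<close>)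
    then show ?thesis by (auto simp: orb_def)
  qed
  obtain f :: "'a \<Rightarrow> nat" where f: "inj_on f S"
    using finite_imp_inj_to_nat_seg[OF assms(1)] by blast
  define j where "j s = (SOME i. (\<sigma> ^^ i) (rep s) = s)" for s
  have j: "(\<sigma> ^^ (j s)) (rep s) = s" for s
  proof -
    have "s \<in> orb (rep s)" using orb_sym rep_in by blast
    then have "\<exists>i. (\<sigma> ^^ i) (rep s) = s" by (metis imageE orb_def)
    then show ?thesis unfolding j_def by (rule someI_ex)
  qed
  have rep_eq: "rep s = rep s'" if "s \<in> S" "s' \<in> S" "f (rep s) = f (rep s')" for s s'
    using inj_onD[OF f] that S_orb rep_in by blast
  show thesis
  proof
    fix s assume s: "s \<in> S"
    show "least_power \<sigma> (rep s) > 0" using least_power_of_permutation[OF perm] by blast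
    show "f (rep (\<sigma> s)) = f (rep s)" by (simp add: rep_\<sigma>)
    have "(\<sigma> ^^ (j (\<sigma> s))) (rep s) = (\<sigma> ^^ (Suc (j s))) (rep s)"
      using j[of "\<sigma> s"] j[of s] by (simp add: rep_\<sigma>)
    from funpow_eq_imp_dvd[OF perm this]
    show "\<exists>l::int. int (j (\<sigma> s)) = int (j s) + 1 + l * int (least_power \<sigma> (rep s))"
      by (simp add: algebra_simps)
    fix s' assume s': "s' \<in> S" and eq: "f (rep s) = f (rep s')"
    then show "least_power \<sigma> (rep s) = least_power \<sigma> (rep s')" using rep_eq s by metis
    fix l assume "int (j s) = int (j s') + l * int (least_power \<sigma> (rep s))"
    from dvd_imp_funpow_eq[OF perm this] show "s = s'"
      unfolding j rep_eq[OF s s' eq] unfolding j[of s'] rep_eq[OF s s' eq, symmetric] j .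
  qed
qed

text \<open>By finiteness the complements of \<open>X\<close> and \<open>Y\<close> in
  \<open>S\<close> are equinumerous, and any bijection between them completes
  \<open>g\<close>.\<close>

lemma bij_betw_extends_to_permutation:
  assumes "finite S" "X \<subseteq> S" "Y \<subseteq> S" "bij_betw g X Y"
  obtains \<sigma> where "\<sigma> permutes S" "\<And>x. x \<in> X \<Longrightarrow> \<sigma> x = g x"
proof -
  have fin: "finite X" "finite Y" using assms finite_subset by auto
  have "card (S - X) = card (S - Y)"
    using assms fin bij_betw_same_card[OF assms(4)] by (simp add: card_Diff_subset)
  then obtain h where h: "bij_betw h (S - X) (S - Y)"
    using assms(1) by (metis finite_Diff finite_same_card_bij)
  define \<sigma> where "\<sigma> x = (if x \<in> X then g x else if x \<in> S then h x else x)" for x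
  have "bij_betw \<sigma> (X \<union> (S - X)) (Y \<union> (S - Y))"
  proof (rule bij_betw_combine)
    show "bij_betw \<sigma> X Y" using assms(4) by (rule bij_betw_cong[THEN iffD1, rotated]) (simp add: \<sigma>_def)
    show "bij_betw \<sigma> (S - X) (S - Y)" using h by (rule bij_betw_cong[THEN iffD1, rotated]) (simp add: \<sigma>_def)
  qed auto
  moreover have "X \<union> (S - X) = S" "Y \<union> (S - Y) = S" using assms by auto
  ultimately have "\<sigma> permutes S"
    using assms(2) by (intro bij_imp_permutes) (auto simp: \<sigma>_def)
  then show thesis by (rule that) (simp add: \<sigma>_def)
qed

section \<open>The rotation model\<close>

locale orthonormal_pair =
  fixes a b :: "'a::euclidean_space"
  assumes aa: "a \<bullet> a = 1" and bb: "b \<bullet> b = 1" and ab: "a \<bullet> b = 0"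
begin

lemma ba: "b \<bullet> a = 0" using ab by (simp add: inner_commute)

text \<open>Rotation by \<theta> in the plane of \<open>a\<close> and \<open>b\<close>, the identity
  on its orthogonal complement. Writing it as the identity plus a correction avoids decomposing the
  space.\<close>

definition rot :: "real \<Rightarrow> 'a \<Rightarrow> 'a" where
  "rot \<theta> x = x + ((cos \<theta> - 1) * (x \<bullet> a) - sin \<theta> * (x \<bullet> b)) *\<^sub>R a
              + ((cos \<theta> - 1) * (x \<bullet> b) + sin \<theta> * (x \<bullet> a)) *\<^sub>R b"

text \<open>The infinitesimal generator of \<open>rot\<close>, zero on the complement of the
  plane.\<close>

definition rot_gen :: "'a \<Rightarrow> 'a" where
  "rot_gen x = (x \<bullet> a) *\<^sub>R b - (x \<bullet> b) *\<^sub>R a"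

lemma rot_inner_a: "rot \<theta> x \<bullet> a = cos \<theta> * (x \<bullet> a) - sin \<theta> * (x \<bullet> b)"
  and rot_inner_b: "rot \<theta> x \<bullet> b = cos \<theta> * (x \<bullet> b) + sin \<theta> * (x \<bullet> a)"
  by (simp_all add: rot_def inner_add_left aa bb ab ba algebra_simps)

lemma rot_0 [simp]: "rot 0 x = x"
  by (simp add: rot_def)

lemma rot_add: "rot (\<theta> + \<phi>) x = rot \<theta> (rot \<phi> x)"
proof -
  have "rot \<theta> (rot \<phi> x) = rot \<phi> x + ((cos \<theta> - 1) * (rot \<phi> x \<bullet> a) - sin \<theta> * (rot \<phi> x \<bullet> b)) *\<^sub>R a
              + ((cos \<theta> - 1) * (rot \<phi> x \<bullet> b) + sin \<theta> * (rot \<phi> x \<bullet> a)) *\<^sub>R b"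
    by (rule rot_def)
  also have "\<dots> = rot (\<theta> + \<phi>) x"
    unfolding rot_inner_a rot_inner_b
    by (simp add: rot_def cos_add sin_add algebra_simps)
  finally show ?thesis ..
qed

lemma bounded_linear_rot: "bounded_linear (rot \<theta>)"
  unfolding rot_def
  by (intro bounded_linear_add bounded_linear_ident bounded_linear_scaleR_const bounded_linear_sub
      bounded_linear_const_mult bounded_linear_inner_left)

lemmas linear_rot = bounded_linear.linear[OF bounded_linear_rot]

lemma norm_plane_add:
  "(norm (x + p *\<^sub>R a + q *\<^sub>R b))\<^sup>2 = (norm x)\<^sup>2 + (2 * p * (x \<bullet> a) + 2 * q * (x \<bullet> b) + p\<^sup>2 + q\<^sup>2)"
  unfolding power2_norm_eq_inner
  by (simp add: inner_add_left inner_add_right aa bb ab ba inner_commute power2_eq_square algebra_simps)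

lemma norm_rot [simp]: "norm (rot \<theta> x) = norm x"
proof -
  let ?A = "(cos \<theta> - 1) * (x \<bullet> a) - sin \<theta> * (x \<bullet> b)" and ?B = "(cos \<theta> - 1) * (x \<bullet> b) + sin \<theta> * (x \<bullet> a)"
  have "(norm (rot \<theta> x))\<^sup>2 = (norm x)\<^sup>2 + (2 * ?A * (x \<bullet> a) + 2 * ?B * (x \<bullet> b) + ?A\<^sup>2 + ?B\<^sup>2)"
    unfolding rot_def by (rule norm_plane_add)
  also have "2 * ?A * (x \<bullet> a) + 2 * ?B * (x \<bullet> b) + ?A\<^sup>2 + ?B\<^sup>2
      = ((x \<bullet> a)\<^sup>2 + (x \<bullet> b)\<^sup>2) * ((cos \<theta>)\<^sup>2 + (sin \<theta>)\<^sup>2 - 1)"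
    by algebra
  finally show ?thesis by simp
qed

lemma norm_rot_diff: "norm (rot \<theta> x - rot \<theta> y) = norm (x - y)"
  by (metis linear_diff linear_rot norm_rot)

lemma rot_neg_rot [simp]: "rot (- \<theta>) (rot \<theta> x) = x" and rot_rot_neg [simp]: "rot \<theta> (rot (- \<theta>) x) = x"
  by (simp_all add: rot_add[symmetric])

lemma rot_minus_self_norm:
  "(norm (rot \<theta> x - x))\<^sup>2 = (2 - 2 * cos \<theta>) * ((x \<bullet> a)\<^sup>2 + (x \<bullet> b)\<^sup>2)"
proof -
  let ?A = "(cos \<theta> - 1) * (x \<bullet> a) - sin \<theta> * (x \<bullet> b)" and ?B = "(cos \<theta> - 1) * (x \<bullet> b) + sin \<theta> * (x \<bullet> a)"
  have "rot \<theta> x - x = ?A *\<^sub>R a + ?B *\<^sub>R b" by (simp add: rot_def)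
  then have "(norm (rot \<theta> x - x))\<^sup>2 = ?A\<^sup>2 + ?B\<^sup>2"
    using norm_plane_add[of 0 ?A ?B] by simp
  also have "\<dots> = ((cos \<theta>)\<^sup>2 + (sin \<theta>)\<^sup>2 + 1 - 2 * cos \<theta>) * ((x \<bullet> a)\<^sup>2 + (x \<bullet> b)\<^sup>2)"
    by algebra
  finally show ?thesis by simp
qed

lemma bessel_plane: "(x \<bullet> a)\<^sup>2 + (x \<bullet> b)\<^sup>2 \<le> (norm x)\<^sup>2"
proof -
  have "0 \<le> (x - (x \<bullet> a) *\<^sub>R a - (x \<bullet> b) *\<^sub>R b) \<bullet> (x - (x \<bullet> a) *\<^sub>R a - (x \<bullet> b) *\<^sub>R b)"
    by simp
  also have "\<dots> = x \<bullet> x - (x \<bullet> a)\<^sup>2 - (x \<bullet> b)\<^sup>2"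
    by (simp add: inner_diff_left inner_diff_right aa bb ab ba inner_commute power2_eq_square)
  finally show ?thesis by (simp add: power2_norm_eq_inner)
qed

text \<open>The premise is equality in Bessel's inequality, so \<open>p\<close> lies in the plane
  and attains the operator norm of the rotation minus the identity. A rotation that barely moves
  \<open>p\<close> thus barely moves any vector.\<close>

lemma rot_minus_self_le:
  assumes "(p \<bullet> a)\<^sup>2 + (p \<bullet> b)\<^sup>2 = (norm p)\<^sup>2"
  shows "norm (rot \<theta> q - q) * norm p \<le> norm (rot \<theta> p - p) * norm q"
proof (rule power2_le_imp_le)
  have "(norm (rot \<theta> q - q) * norm p)\<^sup>2 = (2 - 2 * cos \<theta>) * ((q \<bullet> a)\<^sup>2 + (q \<bullet> b)\<^sup>2) * (norm p)\<^sup>2"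
    by (simp add: power_mult_distrib rot_minus_self_norm)
  also have "\<dots> \<le> (2 - 2 * cos \<theta>) * (norm q)\<^sup>2 * (norm p)\<^sup>2"
    by (intro mult_right_mono mult_left_mono bessel_plane) auto
  also have "\<dots> = (norm (rot \<theta> p - p) * norm q)\<^sup>2"
    by (simp add: power_mult_distrib rot_minus_self_norm assms)
  finally show "(norm (rot \<theta> q - q) * norm p)\<^sup>2 \<le> (norm (rot \<theta> p - p) * norm q)\<^sup>2" .
qed simp

text \<open>The rotating frame removes the drift \<open>\<omega> *\<^sub>R rot_gen\<close> exactly;
  an unperturbed trajectory is at rest in it.\<close>

lemma rot_frame_derivative:
  assumes "(\<zeta> has_vector_derivative \<zeta>') (at t)"
  shows "((\<lambda>t. rot (- (\<omega> * t)) (\<zeta> t)) has_vector_derivative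
           rot (- (\<omega> * t)) (\<zeta>' - \<omega> *\<^sub>R rot_gen (\<zeta> t))) (at t)"
proof -
  have 1: "((\<lambda>t. \<zeta> t \<bullet> e) has_real_derivative \<zeta>' \<bullet> e) (at t)" for e
    unfolding has_real_derivative_iff_has_vector_derivative
    by (rule bounded_linear.has_vector_derivative[OF bounded_linear_inner_left assms])
  show ?thesis
    unfolding rot_def
    by (rule has_vector_derivative_eq_rhs)
       (auto intro!: derivative_eq_intros has_vector_derivative_scaleR assms 1 simp: rot_gen_def aa bb ab ba
          inner_diff_left algebra_simps)
qed

lemma continuous_on_rot [continuous_intros]:
  fixes f :: "'c::t2_space \<Rightarrow> real"
  shows "continuous_on A f \<Longrightarrow> continuous_on A g \<Longrightarrow> continuous_on A (\<lambda>x. rot (f x) (g x))"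
  unfolding rot_def by (intro continuous_intros)

lemma continuous_on_rot_gen [continuous_intros]:
  "continuous_on A g \<Longrightarrow> continuous_on A (\<lambda>x. rot_gen (g x))"
  unfolding rot_gen_def by (intro continuous_intros)

end


section \<open>Closed orbits realizing a permutation\<close>

context orthonormal_pair
begin

lemma rot_a_eq_iff:
  assumes "rot \<alpha> a = rot \<beta> a"
  shows "\<exists>n::int. \<alpha> = \<beta> + 2 * pi * n"
proof -
  have "cos \<alpha> = cos \<beta>" using arg_cong[OF assms, of "\<lambda>x. x \<bullet> a"] by (simp add: rot_inner_a aa ab)
  moreover have "sin \<alpha> = sin \<beta>" using arg_cong[OF assms, of "\<lambda>x. x \<bullet> b"] by (simp add: rot_inner_b aa ab)
  ultimately show ?thesis using sin_cos_eq_iff by blast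
qed

lemma rot_a_periodic: "rot (\<alpha> + 2 * pi * of_int n) a = rot \<alpha> a"
proof -
  have "rot (2 * pi * of_int n) a = a" by (simp add: rot_def)
  then show ?thesis by (simp add: rot_add)
qed

text \<open>Each cycle of \<open>\<sigma>\<close> is placed on its own circle about the origin, equally spaced, so that it is
  permuted by the rotation through one step; \<open>\<omega>\<close> is the corresponding angular velocity.\<close>

lemma rotation_model:
  fixes S :: "'s set"
  assumes S: "finite S" and \<sigma>: "\<sigma> permutes S" and T: "T > 0"
  obtains P :: "'s \<Rightarrow> 'a" and c :: "'s \<Rightarrow> nat" and \<omega> :: "'s \<Rightarrow> real" where
    "\<And>s. s \<in> S \<Longrightarrow> norm (P s) = 1 + real (c s)"
    "\<And>s. s \<in> S \<Longrightarrow> (P s \<bullet> a)\<^sup>2 + (P s \<bullet> b)\<^sup>2 = (norm (P s))\<^sup>2"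
    "\<And>s. s \<in> S \<Longrightarrow> rot (\<omega> s * T) (P s) = P (\<sigma> s)"
    "inj_on P S"
    "\<And>s s'. s \<in> S \<Longrightarrow> s' \<in> S \<Longrightarrow> c s = c s' \<Longrightarrow> \<omega> s = \<omega> s'"
    "\<And>s s' t. s \<in> S \<Longrightarrow> s' \<in> S \<Longrightarrow> t \<in> {0..T} \<Longrightarrow>
       rot (\<omega> s * t) (P s) = rot (\<omega> s' * (T / 2)) (P s') \<Longrightarrow> s = s'"
proof -
  obtain c k j :: "'s \<Rightarrow> nat" where
    k: "\<And>s. s \<in> S \<Longrightarrow> k s > 0"
    and c\<sigma>: "\<And>s. s \<in> S \<Longrightarrow> c (\<sigma> s) = c s"
    and j\<sigma>: "\<And>s. s \<in> S \<Longrightarrow> \<exists>l::int. int (j (\<sigma> s)) = int (j s) + 1 + l * int (k s)"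
    and ck: "\<And>s s'. s \<in> S \<Longrightarrow> s' \<in> S \<Longrightarrow> c s = c s' \<Longrightarrow> k s = k s'"
    and cj: "\<And>s s' l. s \<in> S \<Longrightarrow> s' \<in> S \<Longrightarrow> c s = c s' \<Longrightarrow> int (j s) = int (j s') + l * int (k s) \<Longrightarrow> s = s'"
    by (rule cycle_coordinates[OF S \<sigma>], rule that) assumption+
  define \<omega> where "\<omega> s = 2 * pi / (real (k s) * T)" for s
  \<comment> \<open>The radii \<open>1 + c s\<close> keep different circles at distance at least 1
    and all of them away from the origin, where the rotation is at rest.\<close>
  define P where "P s = (1 + real (c s)) *\<^sub>R rot (2 * pi * real (j s) / real (k s)) a" for s
  have na: "norm a = 1" by (simp add: norm_eq_sqrt_inner aa)
  have nP: "norm (P s) = 1 + real (c s)" for s by (simp add: P_def na)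
  have rotP: "rot \<theta> (P s) = (1 + real (c s)) *\<^sub>R rot (\<theta> + 2 * pi * real (j s) / real (k s)) a" for \<theta> s
    by (simp add: P_def linear_scale[OF linear_rot] rot_add)
  \<comment> \<open>Equal norms put both points on one circle, hence on one cycle; equal angles then
    say that the fractional positions t / T + j agree modulo the cycle length.\<close>
  have coincide: "c s = c s' \<and> (\<exists>n::int. t / T + real (j s) = t' / T + real (j s') + of_int n * real (k s))"
    if s: "s \<in> S" "s' \<in> S" and eq: "rot (\<omega> s * t) (P s) = rot (\<omega> s' * t') (P s')" for s s' t t'
  proof -
    have "norm (P s) = norm (P s')" using arg_cong[OF eq, of norm] by simp
    then have c: "c s = c s'" by (simp add: nP)
    have ks: "k s' = k s" using ck[OF s c] ..
    have "rot (\<omega> s * t + 2 * pi * real (j s) / real (k s)) a = rot (\<omega> s' * t' + 2 * pi * real (j s') / real (k s')) a"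
      using eq unfolding rotP c scaleR_cancel_left by (auto simp: add_nonneg_eq_0_iff)
    then obtain n :: int where
      "\<omega> s * t + 2 * pi * real (j s) / real (k s) = \<omega> s' * t' + 2 * pi * real (j s') / real (k s') + 2 * pi * of_int n"
      using rot_a_eq_iff by blast
    moreover have "\<omega> s * t + 2 * pi * real (j s) / real (k s) = 2 * pi / real (k s) * (t / T + real (j s))"
      "\<omega> s' * t' + 2 * pi * real (j s') / real (k s') + 2 * pi * of_int n
        = 2 * pi / real (k s) * (t' / T + real (j s') + of_int n * real (k s))"
      using k[OF s(1)] T by (simp_all add: \<omega>_def ks field_simps)
    ultimately have "2 * pi / real (k s) * (t / T + real (j s))
        = 2 * pi / real (k s) * (t' / T + real (j s') + of_int n * real (k s))" by linarith
    then have "t / T + real (j s) = t' / T + real (j s') + of_int n * real (k s)"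
      using k[OF s(1)] by simp
    with c show ?thesis by blast
  qed
  show thesis
  proof
    show "norm (P s) = 1 + real (c s)" for s by (rule nP)
    show "(P s \<bullet> a)\<^sup>2 + (P s \<bullet> b)\<^sup>2 = (norm (P s))\<^sup>2" for s
    proof -
      have "(P s \<bullet> a)\<^sup>2 + (P s \<bullet> b)\<^sup>2 = (1 + real (c s))\<^sup>2 *
          ((cos (2 * pi * real (j s) / real (k s)))\<^sup>2 + (sin (2 * pi * real (j s) / real (k s)))\<^sup>2)"
        by (simp only: P_def inner_scaleR_left rot_inner_a rot_inner_b aa ab) algebra
      also have "\<dots> = (norm (P s))\<^sup>2"
        by (simp only: nP sin_cos_squared_add2 mult_1_right)
      finally show ?thesis .
    qed
    show "\<omega> s = \<omega> s'" if "s \<in> S" "s' \<in> S" "c s = c s'" for s s'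
      unfolding \<omega>_def ck[OF that] ..
    show "inj_on P S"
    proof (rule inj_onI)
      fix s s' assume s: "s \<in> S" "s' \<in> S" "P s = P s'"
      then obtain n :: int where "c s = c s'" "real (j s) = real (j s') + of_int n * real (k s)"
        using coincide[of s s' 0 0] by auto
      moreover from this(2) have "int (j s) = int (j s') + n * int (k s)"
        by (metis (mono_tags, lifting) of_int_add of_int_eq_iff of_int_mult of_int_of_nat_eq)
      ultimately show "s = s'" using cj s by blast
    qed
    show "s = s'" if s: "s \<in> S" "s' \<in> S" and t: "t \<in> {0..T}"
      and eq: "rot (\<omega> s * t) (P s) = rot (\<omega> s' * (T / 2)) (P s')" for s s' t
    proof -
      obtain n :: int where c: "c s = c s'" and n: "t / T + real (j s) = T / 2 / T + real (j s') + of_int n * real (k s)"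
        using coincide[OF s eq] by blast
      \<comment> \<open>As t / T lies between 0 and 1, the integer \<open>m = t / T - 1/2\<close>
        can only be 0. At an endpoint instead of the midpoint, neighbouring arcs would meet.\<close>
      define m where "m = int (j s') + n * int (k s) - int (j s)"
      have m: "of_int m = t / T - 1 / 2" using n T by (simp add: m_def)
      have "0 \<le> t / T" "t / T \<le> 1" using t T by auto
      then have "\<bar>of_int m :: real\<bar> < 1" unfolding m by linarith
      then have "m = 0" by linarith
      then have "int (j s) = int (j s') + n * int (k s)" by (simp add: m_def)
      then show ?thesis using cj s c by blast
    qed
    show "rot (\<omega> s * T) (P s) = P (\<sigma> s)" if s: "s \<in> S" for s
    proof -
      obtain l :: int where l: "int (j (\<sigma> s)) = int (j s) + 1 + l * int (k s)"
        using j\<sigma>[OF s] by blast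
      then have jr: "real (j (\<sigma> s)) = real (j s) + 1 + of_int l * real (k s)"
        by (metis (mono_tags, lifting) of_int_1 of_int_add of_int_mult of_int_of_nat_eq)
      have \<sigma>S: "\<sigma> s \<in> S" using s \<sigma> by (simp add: permutes_in_image)
      have ks: "k (\<sigma> s) = k s" using ck[OF \<sigma>S s] c\<sigma>[OF s] by simp
      have "2 * pi * real (j (\<sigma> s)) / real (k s) = (\<omega> s * T + 2 * pi * real (j s) / real (k s)) + 2 * pi * of_int l"
        using k[OF s] T unfolding jr \<omega>_def by (simp add: field_simps)
      then show ?thesis
        unfolding rotP P_def[of "\<sigma> s"] ks c\<sigma>[OF s] by (simp add: rot_a_periodic)
    qed
  qed
qed

text \<open>In the frame rotating with the unperturbed trajectory only the perturbation \<open>X\<close> is felt, and to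
  first order it may be evaluated along the unperturbed trajectory.\<close>

lemma rotating_displacement:
  assumes \<zeta>: "\<And>t. (\<zeta> has_vector_derivative Z t) (at t)"
    and Z: "\<And>t. t \<in> {0..T} \<Longrightarrow> norm (rot (- (\<omega> * t)) (\<zeta> t) - \<zeta> 0) \<le> r \<Longrightarrow>
              norm (Z t - \<omega> *\<^sub>R rot_gen (\<zeta> t) - X (\<zeta> t)) \<le> \<epsilon>"
    and X: "\<And>x. norm (X x) \<le> m" "\<And>x x'. norm (X x - X x') \<le> L * norm (x - x')" "L \<ge> 0"
    and small: "T * (m + \<epsilon>) < r" "0 \<le> \<epsilon>" "0 \<le> T"
    and e: "norm e = 1" and \<phi>: "continuous_on {0..T} \<phi>"
    and along: "\<And>t. t \<in> {0..T} \<Longrightarrow> \<mu> * \<phi> t \<le> rot (- (\<omega> * t)) (X (rot (\<omega> * t) (\<zeta> 0))) \<bullet> e"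
  shows "\<mu> * integral {0..T} \<phi> - T * (\<epsilon> + L * (T * (m + \<epsilon>))) \<le> (rot (- (\<omega> * T)) (\<zeta> T) - \<zeta> 0) \<bullet> e"
proof -
  define y where "y t = rot (- (\<omega> * t)) (\<zeta> t)" for t
  define Y where "Y t = rot (- (\<omega> * t)) (Z t - \<omega> *\<^sub>R rot_gen (\<zeta> t))" for t
  have y0: "y 0 = \<zeta> 0" by (simp add: y_def)
  have m0: "0 \<le> m" using X(1) norm_ge_zero order_trans by blast
  have y: "(y has_vector_derivative Y t) (at t)" for t
    unfolding y_def Y_def by (rule rot_frame_derivative[OF \<zeta>])
  have Y: "norm (Y t - rot (- (\<omega> * t)) (X (\<zeta> t))) \<le> \<epsilon>" if "t \<in> {0..T}" "norm (y t - y 0) \<le> r" for t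
    using Z[OF that(1)] that(2) unfolding y0 unfolding y_def Y_def by (simp add: norm_rot_diff)
  have "norm (Y t) \<le> m + \<epsilon>" if "t \<in> {0..T}" "norm (y t - y 0) \<le> r" for t
    using norm_triangle_ineq[of "Y t - rot (- (\<omega> * t)) (X (\<zeta> t))" "rot (- (\<omega> * t)) (X (\<zeta> t))"] Y[OF that] X(1)[of "\<zeta> t"]
    by simp
  then have disp: "norm (y t - y 0) \<le> T * (m + \<epsilon>)" if "t \<in> {0..T}" for t
    using displacement_small[OF y _ small(1) _ small(3) that] small(2) m0 by simp
  \<comment> \<open>Two losses: \<open>\<epsilon>\<close> for the error of the field, and
    \<open>L * (T * (m + \<epsilon>))\<close> for evaluating \<open>X\<close> on the unperturbed
    circle instead of at the true position.\<close>
  have lower: "\<mu> * \<phi> t - (\<epsilon> + L * (T * (m + \<epsilon>))) \<le> Y t \<bullet> e" if t: "t \<in> {0..T}" for t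
  proof -
    let ?X0 = "rot (- (\<omega> * t)) (X (rot (\<omega> * t) (\<zeta> 0)))"
    have "norm (y t - y 0) = norm (rot (\<omega> * t) (y t) - rot (\<omega> * t) (y 0))"
      by (simp only: norm_rot_diff)
    then have "norm (\<zeta> t - rot (\<omega> * t) (\<zeta> 0)) \<le> T * (m + \<epsilon>)"
      using disp[OF t] by (simp add: y_def)
    then have "norm (X (\<zeta> t) - X (rot (\<omega> * t) (\<zeta> 0))) \<le> L * (T * (m + \<epsilon>))"
      using X(2,3) by (meson mult_left_mono order_trans)
    then have 1: "norm (rot (- (\<omega> * t)) (X (\<zeta> t)) - ?X0) \<le> L * (T * (m + \<epsilon>))"
      by (simp only: norm_rot_diff)
    have 2: "norm (Y t - rot (- (\<omega> * t)) (X (\<zeta> t))) \<le> \<epsilon>"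
      using Y[OF t] disp[OF t] small(1) by linarith
    have "norm (Y t - ?X0) \<le> \<epsilon> + L * (T * (m + \<epsilon>))"
      using norm_triangle_mono[OF 2 1] by simp
    then have "(?X0 - Y t) \<bullet> e \<le> \<epsilon> + L * (T * (m + \<epsilon>))"
      using norm_cauchy_schwarz[of "?X0 - Y t" e] e by (simp add: norm_minus_commute)
    with along[OF t] show ?thesis by (simp add: inner_diff_left)
  qed
  have I: "((\<lambda>t. Y t \<bullet> e) has_integral (y T \<bullet> e - y 0 \<bullet> e)) {0..T}"
  proof (rule fundamental_theorem_of_calculus[OF small(3)])
    show "((\<lambda>t. y t \<bullet> e) has_vector_derivative Y t \<bullet> e) (at t within {0..T})" for t
      by (rule has_vector_derivative_at_within,
          rule bounded_linear.has_vector_derivative[OF bounded_linear_inner_left y])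
  qed
  have J: "((\<lambda>t. \<mu> * \<phi> t - (\<epsilon> + L * (T * (m + \<epsilon>)))) has_integral
      (\<mu> * integral {0..T} \<phi> - T * (\<epsilon> + L * (T * (m + \<epsilon>))))) {0..T}"
    using has_integral_const_real[of "\<epsilon> + L * (T * (m + \<epsilon>))" 0 T] small(3)
    by (intro has_integral_diff has_integral_mult_right integrable_integral integrable_continuous_real \<phi>) simp
  have "\<mu> * integral {0..T} \<phi> - T * (\<epsilon> + L * (T * (m + \<epsilon>))) \<le> y T \<bullet> e - y 0 \<bullet> e"
    by (rule has_integral_le[OF J I lower])
  then show ?thesis by (simp add: y_def inner_diff_left)
qed

end

section \<open>Perturbing the model\<close>

text \<open>The pullback of \<open>W\<close> is approximated in the original coordinates. A sup-norm
  error survives the change of coordinates up to the bound \<open>B\<close> of the differential on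
  the compact preimage of the ball, whence the tolerance \<open>e / B\<close>.\<close>

lemma pushforward_dense:
  fixes \<F> :: "('a::euclidean_space \<Rightarrow> 'a) set"
  assumes dense: "\<And>U R e. continuous_on UNIV U \<Longrightarrow> e > 0 \<Longrightarrow> \<exists>V\<in>\<F>. \<forall>x. norm x \<le> R \<longrightarrow> norm (V x - U x) < (e::real)"
    and \<psi>: "C1_diffeo \<psi> \<phi> D E" and W: "continuous_on UNIV W" and e: "e > 0"
  obtains V where "V \<in> \<F>" "\<And>x. norm (\<psi> x) \<le> R \<Longrightarrow> norm (D x (V x) - W (\<psi> x)) \<le> e"
proof -
  have cont: "continuous_on UNIV \<psi>" "continuous_on UNIV \<phi>"
    using \<psi> unfolding C1_diffeo_def by (auto intro: continuous_at_imp_continuous_on has_derivative_continuous)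
  have K: "compact (\<phi> ` cball 0 R)"
    by (intro compact_continuous_image continuous_on_subset[OF cont(2)]) auto
  obtain B where B: "B > 0" "\<And>x v. x \<in> \<phi> ` cball 0 R \<Longrightarrow> norm (D x v) \<le> B * norm v"
    by (rule C1_diffeo_derivative_bounded[OF \<psi> K]) blast
  obtain R' where "\<forall>x\<in>\<phi> ` cball 0 R. norm x \<le> R'"
    using compact_imp_bounded[OF K] unfolding bounded_iff by (elim exE)
  then have R': "\<And>x. x \<in> \<phi> ` cball 0 R \<Longrightarrow> norm x \<le> R'" by blast
  have pair: "continuous_on UNIV (\<lambda>x. (x, W (\<psi> x)))"
    by (intro continuous_on_Pair continuous_on_id continuous_on_compose2[OF W cont(1)]) auto
  have "continuous_on UNIV (\<lambda>(x, v). E x v)"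
    using \<psi> by (simp add: C1_diffeo_def)
  from continuous_on_compose2[OF this pair]
  have "continuous_on UNIV (\<lambda>x. E x (W (\<psi> x)))" by simp
  then obtain V where V: "V \<in> \<F>" "\<And>x. norm x \<le> R' \<Longrightarrow> norm (V x - E x (W (\<psi> x))) < e / B"
    using dense[of "\<lambda>x. E x (W (\<psi> x))" "e / B" R'] B(1) e by auto
  show thesis
  proof (rule that[OF V(1)])
    fix x assume "norm (\<psi> x) \<le> R"
    then have x: "x \<in> \<phi> ` cball 0 R"
      using \<psi> unfolding C1_diffeo_def by (intro image_eqI[of _ _ "\<psi> x"]) auto
    have "bounded_linear (D x)"
      using \<psi> unfolding C1_diffeo_def by (blast intro: has_derivative_bounded_linear)
    then have "D x (V x) - W (\<psi> x) = D x (V x - E x (W (\<psi> x)))"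
      using \<psi> unfolding C1_diffeo_def by (simp add: bounded_linear.linear linear_diff)
    also have "norm \<dots> \<le> B * norm (V x - E x (W (\<psi> x)))"
      by (rule B(2)[OF x])
    also have "\<dots> \<le> B * (e / B)"
      using V(2)[OF R'[OF x]] B(1) by (intro mult_left_mono) auto
    finally show "norm (D x (V x) - W (\<psi> x)) \<le> e" using B(1) by simp
  qed
qed

section \<open>Scalar profiles and the choice of the amplitude\<close>

lemma finite_positive_lower_bound:
  fixes f :: "'i \<Rightarrow> real"
  assumes "finite A" "\<And>x. x \<in> A \<Longrightarrow> f x > 0"
  obtains d where "d > 0" "\<And>x. x \<in> A \<Longrightarrow> d \<le> f x"
proof
  \<comment> \<open>Inserting 1 covers the case of an empty \<open>A\<close>.\<close>
  show "Min (insert 1 (f ` A)) > 0" using assms by auto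
  show "Min (insert 1 (f ` A)) \<le> f x" if "x \<in> A" for x
    using assms(1) that by (intro Min_le) auto
qed

text \<open>Makes the angular velocity a continuous function of the radius alone. Each summand
  equals its constant up to distance 1/4 from its circle and vanishes from distance 1/2 on; a radius
  within 1/4 of one circle is at least 3/4 away from the others.\<close>

lemma speed_profile:
  fixes c :: "'s \<Rightarrow> nat" and \<omega> :: "'s \<Rightarrow> real"
  assumes S: "finite S" and \<omega>: "\<And>s s'. s \<in> S \<Longrightarrow> s' \<in> S \<Longrightarrow> c s = c s' \<Longrightarrow> \<omega> s = \<omega> s'"
  obtains h where "continuous_on UNIV h"
    "\<And>s r. s \<in> S \<Longrightarrow> \<bar>r - (1 + real (c s))\<bar> \<le> 1 / 4 \<Longrightarrow> h r = \<omega> s"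
proof -
  define w where "w m = \<omega> (SOME s. s \<in> S \<and> c s = m)" for m
  have w: "w (c s) = \<omega> s" if "s \<in> S" for s
  proof -
    have "(SOME s'. s' \<in> S \<and> c s' = c s) \<in> S \<and> c (SOME s'. s' \<in> S \<and> c s' = c s) = c s"
      by (rule someI[of _ s]) (use that in auto)
    then show ?thesis unfolding w_def using \<omega> that by blast
  qed
  define h where "h r = (\<Sum>m\<in>c ` S. w m * max 0 (min 1 (2 - 4 * \<bar>r - (1 + real m)\<bar>)))" for r
  show thesis
  proof
    show "continuous_on UNIV h" unfolding h_def by (intro continuous_intros)
    fix s r assume s: "s \<in> S" and r: "\<bar>r - (1 + real (c s))\<bar> \<le> 1 / 4"
    have "w m * max 0 (min 1 (2 - 4 * \<bar>r - (1 + real m)\<bar>)) = (if m = c s then \<omega> s else 0)" if "m \<in> c ` S" for m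
    proof (cases "m = c s")
      case True
      then show ?thesis using r w[OF s] by (simp add: max_def min_def)
    next
      case False
      then have "real m \<ge> real (c s) + 1 \<or> real (c s) \<ge> real m + 1" by linarith
      then have "2 - 4 * \<bar>r - (1 + real m)\<bar> \<le> 0"
        using r unfolding abs_le_iff by (auto simp: abs_real_def)
      with False show ?thesis by (simp add: max_def)
    qed
    then have "h r = (\<Sum>m\<in>c ` S. if m = c s then \<omega> s else 0)" unfolding h_def by (rule sum.cong[OF refl])
    then show "h r = \<omega> s" using S s by simp
  qed
qed

text \<open>A cutoff with the explicit Lipschitz constant 1 / r, which enters the choice of the
  amplitude.\<close>

definition tent :: "real \<Rightarrow> 'a::real_normed_vector \<Rightarrow> 'a \<Rightarrow> real" where
  "tent r p x = max 0 (1 - norm (x - p) / r)"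

lemma tent_nonneg: "0 \<le> tent r p x"
  and tent_le_1: "r > 0 \<Longrightarrow> tent r p x \<le> 1"
  and tent_center: "tent r p p = 1"
  by (auto simp: tent_def)

lemma tent_eq_0: "r > 0 \<Longrightarrow> r \<le> norm (x - p) \<Longrightarrow> tent r p x = 0"
  by (auto simp: tent_def field_simps)

lemma tent_lipschitz:
  assumes "r > 0" shows "\<bar>tent r p x - tent r p y\<bar> \<le> norm (x - y) / r"
proof -
  have "\<bar>norm (x - p) - norm (y - p)\<bar> \<le> norm (x - y)"
    using norm_triangle_ineq3[of "x - p" "y - p"] by simp
  then have "\<bar>norm (x - p) - norm (y - p)\<bar> / r \<le> norm (x - y) / r"
    using assms by (simp add: divide_right_mono)
  moreover have "\<bar>norm (x - p) - norm (y - p)\<bar> / r = \<bar>norm (x - p) / r - norm (y - p) / r\<bar>"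
    using assms by (simp add: diff_divide_distrib[symmetric])
  ultimately show ?thesis unfolding tent_def by linarith
qed

lemma continuous_on_tent [continuous_intros]:
  "r > 0 \<Longrightarrow> continuous_on A f \<Longrightarrow> continuous_on A (\<lambda>x. tent r p (f x))"
  unfolding tent_def by (intro continuous_intros) auto

text \<open>All three quantities vanish with \<rho>. The first bound lets \<open>n\<close>
  perturbation errors of size \<rho>^3 fit into \<rho>^2, the second keeps trajectories where the
  speed profile is constant, and the third makes the total error, divided by \<rho>, smaller than
  the gain.\<close>

lemma small_amplitude:
  fixes c n K T :: real
  assumes "c > 0"
  obtains \<rho> where "\<rho> > 0" "n * \<rho> \<le> 1" "T * (n * \<rho> + 2 * \<rho>\<^sup>2) < 1 / 4"
    "T * (2 * \<rho> + K * (T * (n * \<rho> + 2 * \<rho>\<^sup>2))) < c"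
proof -
  have lim: "((\<lambda>\<rho>. n * \<rho>) \<longlongrightarrow> n * 0) (at_right 0)"
    "((\<lambda>\<rho>. T * (n * \<rho> + 2 * \<rho>\<^sup>2)) \<longlongrightarrow> T * (n * 0 + 2 * 0\<^sup>2)) (at_right 0)"
    "((\<lambda>\<rho>. T * (2 * \<rho> + K * (T * (n * \<rho> + 2 * \<rho>\<^sup>2)))) \<longlongrightarrow> T * (2 * 0 + K * (T * (n * 0 + 2 * 0\<^sup>2)))) (at_right 0)"
    by (intro tendsto_intros)+
  have "\<forall>\<^sub>F \<rho> in at_right 0. n * \<rho> < 1" "\<forall>\<^sub>F \<rho> in at_right 0. T * (n * \<rho> + 2 * \<rho>\<^sup>2) < 1 / 4"
    "\<forall>\<^sub>F \<rho> in at_right 0. T * (2 * \<rho> + K * (T * (n * \<rho> + 2 * \<rho>\<^sup>2))) < c"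
    using assms order_tendstoD(2)[OF lim(1), of 1] order_tendstoD(2)[OF lim(2), of "1 / 4"]
      order_tendstoD(2)[OF lim(3), of c] by simp_all
  then have "\<forall>\<^sub>F \<rho> in at_right 0. \<rho> > 0 \<and> n * \<rho> < 1 \<and> T * (n * \<rho> + 2 * \<rho>\<^sup>2) < 1 / 4 \<and>
    T * (2 * \<rho> + K * (T * (n * \<rho> + 2 * \<rho>\<^sup>2))) < c"
    using eventually_at_right_less[of "0::real"] by eventually_elim simp
  then obtain \<rho> where "\<rho> > 0 \<and> n * \<rho> < 1 \<and> T * (n * \<rho> + 2 * \<rho>\<^sup>2) < 1 / 4 \<and>
    T * (2 * \<rho> + K * (T * (n * \<rho> + 2 * \<rho>\<^sup>2))) < c"
    using eventually_happens'[OF trivial_limit_at_right_real] by blast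
  then show thesis using that[of \<rho>] by auto
qed

lemma subspace_combination:
  assumes "field_space.subspace \<F>" "V\<^sub>0 \<in> \<F>" "\<And>j. j < n \<Longrightarrow> V j \<in> \<F>"
  shows "(\<lambda>x. V\<^sub>0 x + (\<Sum>j<(n::nat). p j *\<^sub>R V j x)) \<in> \<F>"
  using assms(3)
proof (induction n)
  case 0
  then show ?case using assms(2) by simp
next
  case (Suc n)
  have "(\<lambda>x. V\<^sub>0 x + (\<Sum>j<n. p j *\<^sub>R V j x)) + scale_field (p n) (V n) \<in> \<F>"
    using Suc assms(1) by (intro field_space.subspace_add field_space.subspace_scale) auto
  then show ?case
    by (simp add: plus_fun_def scale_field_def add.assoc)
qed

section \<open>The endpoint map and its zero\<close>

context orthonormal_pair
begin

text \<open>On the support of the tent the rotation that carries the midpoint of the arc to the current point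
  is close to the identity, so the drive along the arc is nearly parallel to the parameter \<open>q\<close>.\<close>

lemma tent_drive:
  assumes p: "(p \<bullet> a)\<^sup>2 + (p \<bullet> b)\<^sup>2 = (norm p)\<^sup>2" "1 \<le> norm p" and e: "norm e = 1"
    and r: "r > 0" "r * norm q \<le> m / 2" and q: "m \<le> q \<bullet> e"
  shows "m / 2 * tent r (rot \<tau> p) (rot \<alpha> p)
    \<le> rot (- \<alpha>) (tent r (rot \<tau> p) (rot \<alpha> p) *\<^sub>R rot \<tau> q) \<bullet> e"
proof (cases "r \<le> norm (rot \<alpha> p - rot \<tau> p)")
  case True
  then show ?thesis using tent_eq_0[OF r(1) True] by (simp add: linear_0[OF linear_rot])
next
  case False
  have "rot \<tau> p - rot \<alpha> p = rot \<alpha> (rot (\<tau> - \<alpha>) p) - rot \<alpha> p"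
    by (simp add: rot_add[symmetric])
  then have "norm (rot (\<tau> - \<alpha>) p - p) = norm (rot \<tau> p - rot \<alpha> p)"
    by (simp only: norm_rot_diff)
  then have d: "norm (rot (\<tau> - \<alpha>) p - p) \<le> r"
    using False by (simp add: norm_minus_commute)
  have "norm (rot (\<tau> - \<alpha>) q - q) * 1 \<le> norm (rot (\<tau> - \<alpha>) q - q) * norm p"
    using p(2) by (intro mult_left_mono) auto
  also have "\<dots> \<le> norm (rot (\<tau> - \<alpha>) p - p) * norm q"
    by (rule rot_minus_self_le[OF p(1)])
  also have "\<dots> \<le> r * norm q" using d by (intro mult_right_mono) auto
  finally have "norm (rot (\<tau> - \<alpha>) q - q) \<le> m / 2" using r(2) by simp
  then have "(q - rot (\<tau> - \<alpha>) q) \<bullet> e \<le> m / 2"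
    using norm_cauchy_schwarz[of "q - rot (\<tau> - \<alpha>) q" e] e by (simp add: norm_minus_commute)
  then have "m / 2 \<le> rot (\<tau> - \<alpha>) q \<bullet> e" using q by (simp add: inner_diff_left)
  then have "m / 2 * tent r (rot \<tau> p) (rot \<alpha> p) \<le> (rot (\<tau> - \<alpha>) q \<bullet> e) * tent r (rot \<tau> p) (rot \<alpha> p)"
    by (intro mult_right_mono tent_nonneg)
  moreover have "rot (- \<alpha>) (rot \<tau> q) = rot (\<tau> - \<alpha>) q"
    by (simp add: rot_add[symmetric])
  ultimately show ?thesis
    by (simp add: linear_scale[OF linear_rot] mult.commute)
qed

theorem permutation_realized:
  fixes \<F> :: "('a \<Rightarrow> 'a) set"
  assumes dim: "DIM('a) \<ge> 2" and sub: "field_space.subspace \<F>"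
    and lip: "\<And>V. V \<in> \<F> \<Longrightarrow> locally_lipschitz V"
    and glob: "\<And>V. V \<in> \<F> \<Longrightarrow> generates_global_flow V"
    and dense: "\<And>U R e. continuous_on UNIV U \<Longrightarrow> e > 0 \<Longrightarrow> \<exists>V\<in>\<F>. \<forall>x. norm x \<le> R \<longrightarrow> norm (V x - U x) < (e::real)"
    and S: "finite S" and \<sigma>: "\<sigma> permutes S" and T: "T > 0"
  shows "\<exists>V\<in>\<F>. \<forall>s\<in>S. flow V T s = \<sigma> s"
proof -
  obtain P c \<omega> where
    normP: "\<And>s. s \<in> S \<Longrightarrow> norm (P s) = 1 + real (c s)"
    and plane: "\<And>s. s \<in> S \<Longrightarrow> (P s \<bullet> a)\<^sup>2 + (P s \<bullet> b)\<^sup>2 = (norm (P s))\<^sup>2"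
    and P\<sigma>: "\<And>s. s \<in> S \<Longrightarrow> rot (\<omega> s * T) (P s) = P (\<sigma> s)"
    and injP: "inj_on P S"
    and c\<omega>: "\<And>s s'. s \<in> S \<Longrightarrow> s' \<in> S \<Longrightarrow> c s = c s' \<Longrightarrow> \<omega> s = \<omega> s'"
    and disj: "\<And>s s' t. s \<in> S \<Longrightarrow> s' \<in> S \<Longrightarrow> t \<in> {0..T} \<Longrightarrow>
       rot (\<omega> s * t) (P s) = rot (\<omega> s' * (T / 2)) (P s') \<Longrightarrow> s = s'"
    by (rule rotation_model[OF S \<sigma> T], rule that) assumption+
  obtain \<psi> \<phi> D E where \<psi>: "C1_diffeo \<psi> \<phi> D E" and \<psi>P: "\<And>s. s \<in> S \<Longrightarrow> \<psi> s = P s"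
    by (rule C1_diffeo_transitive[OF dim S inj_on_id2 injP], rule that) assumption+
  have D: "(\<psi> has_derivative D x) (at x)" and \<phi>\<psi>: "\<phi> (\<psi> x) = x" for x
    using \<psi> by (auto simp: C1_diffeo_def)
  have D_lin: "linear (D x)" for x
    using D by (meson bounded_linear.linear has_derivative_bounded_linear)
  have cont_\<psi>: "continuous_on UNIV \<psi>"
    using D by (auto intro: continuous_at_imp_continuous_on has_derivative_continuous)

  define mid where "mid s = rot (\<omega> s * (T / 2)) (P s)" for s
  \<comment> \<open>Each closed arc is compact and misses the midpoints of all other arcs, so the
    distance is attained and positive.\<close>
  have "\<exists>d>0. \<forall>t\<in>{0..T}. d \<le> norm (rot (\<omega> s * t) (P s) - mid s')"
    if s: "s \<in> S" "s' \<in> S" "s \<noteq> s'" for s s'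
  proof -
    have "\<exists>t0\<in>{0..T}. \<forall>t\<in>{0..T}. norm (rot (\<omega> s * t0) (P s) - mid s') \<le> norm (rot (\<omega> s * t) (P s) - mid s')"
      using T by (intro continuous_attains_inf continuous_intros) auto
    then obtain t0 where t0: "t0 \<in> {0..T}"
      "\<And>t. t \<in> {0..T} \<Longrightarrow> norm (rot (\<omega> s * t0) (P s) - mid s') \<le> norm (rot (\<omega> s * t) (P s) - mid s')" by blast
    moreover have "rot (\<omega> s * t0) (P s) - mid s' \<noteq> 0"
      using disj[OF s(1,2) t0(1)] s(3) by (auto simp: mid_def)
    ultimately show ?thesis by (intro exI[of _ "norm (rot (\<omega> s * t0) (P s) - mid s')"]) auto
  qed
  then obtain dd where dd: "\<And>s s'. s \<in> S \<Longrightarrow> s' \<in> S \<Longrightarrow> s \<noteq> s' \<Longrightarrow> dd s s' > 0"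
    "\<And>s s' t. s \<in> S \<Longrightarrow> s' \<in> S \<Longrightarrow> s \<noteq> s' \<Longrightarrow> t \<in> {0..T} \<Longrightarrow> dd s s' \<le> norm (rot (\<omega> s * t) (P s) - mid s')"
    by metis
  have "finite {z \<in> S \<times> S. fst z \<noteq> snd z}" using S by auto
  then obtain d0 where d0: "d0 > 0" "\<And>z. z \<in> {z \<in> S \<times> S. fst z \<noteq> snd z} \<Longrightarrow> d0 \<le> dd (fst z) (snd z)"
    by (rule finite_positive_lower_bound[where f = "\<lambda>z. dd (fst z) (snd z)"]) (use dd(1) in auto)
  \<comment> \<open>Below \<open>d0\<close>, a tent is not felt on the arc of any other point. The
    second bound serves \<open>tent_drive\<close>: the parameter vector of a point has norm at most
    \<open>DIM('a) * \<rho>\<close>, so \<open>r\<close> times it is at most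
    \<open>\<rho> / 2\<close>.\<close>
  define r where "r = min d0 (1 / (2 * real DIM('a)))"
  have r0: "r > 0" using d0(1) by (simp add: r_def)
  have rN: "r * (real DIM('a) * \<rho>) \<le> \<rho> / 2" if "\<rho> > 0" for \<rho>
  proof -
    have "r * (real DIM('a) * \<rho>) \<le> (1 / (2 * real DIM('a))) * (real DIM('a) * \<rho>)"
      using that by (intro mult_right_mono) (auto simp: r_def)
    then show ?thesis by simp
  qed
  have sep: "r \<le> norm (rot (\<omega> s * t) (P s) - mid s')"
    if "s \<in> S" "s' \<in> S" "s \<noteq> s'" "t \<in> {0..T}" for s s' t
    using dd(2)[OF that] d0(2)[of "(s, s')"] that by (auto simp: r_def)

  \<comment> \<open>The weight with which the unperturbed trajectory from \<open>s\<close> feels its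
    own tent. It is 1 at time \<open>T / 2\<close>, so its integral is positive.\<close>
  define w where "w s t = tent r (mid s) (rot (\<omega> s * t) (P s))" for s t
  have cont_w: "continuous_on {0..T} (w s)" for s
    unfolding w_def by (intro continuous_intros r0)
  have int_w: "integral {0..T} (w s) > 0" for s
  proof -
    have "integral {0..T} (w s) \<noteq> 0"
      using T integral_eq_0_iff[OF cont_w T, of s] tent_center[of r "mid s"]
      by (auto simp: w_def tent_nonneg mid_def intro!: bexI[of _ "T / 2"])
    moreover have "integral {0..T} (w s) \<ge> 0"
      by (rule integral_nonneg[OF integrable_continuous_real[OF cont_w]]) (simp add: w_def tent_nonneg)
    ultimately show ?thesis by simp
  qed
  obtain c0 where c0: "c0 > 0" "\<And>s. s \<in> S \<Longrightarrow> c0 \<le> integral {0..T} (w s)"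
    by (rule finite_positive_lower_bound[OF S, of "\<lambda>s. integral {0..T} (w s)"]) (use int_w in auto)

  \<comment> \<open>One parameter and one equation for each pair of a point and a basis direction;
    \<open>h\<close> numbers the pairs.\<close>
  define n where "n = card (S \<times> (Basis :: 'a set))"
  obtain h where h: "bij_betw h {..<n} (S \<times> (Basis :: 'a set))"
    using ex_bij_betw_nat_finite[of "S \<times> (Basis :: 'a set)"] S
    by (auto simp: n_def atLeast0LessThan)
  have hS: "fst (h j) \<in> S" "snd (h j) \<in> Basis" if "j < n" for j
    using bij_betwE[OF h] that by (auto simp: mem_Times_iff)
  have h_inj: "i = j" if "h i = h j" "i < n" "j < n" for i j
    using bij_betw_imp_inj_on[OF h] that by (auto dest: inj_onD)
  have h_surj: "\<exists>j<n. h j = (s, e)" if "s \<in> S" "e \<in> Basis" for s e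
  proof -
    have "(s, e) \<in> h ` {..<n}" unfolding bij_betw_imp_surj_on[OF h] using that by simp
    then obtain j where "(s, e) = h j" "j \<in> {..<n}" by (rule imageE)
    then show ?thesis by (intro exI[of _ j]) simp
  qed
  obtain \<rho> where \<rho>: "\<rho> > 0" "real n * \<rho> \<le> 1" "T * (real n * \<rho> + 2 * \<rho>\<^sup>2) < 1 / 4"
    "T * (2 * \<rho> + real n / r * (T * (real n * \<rho> + 2 * \<rho>\<^sup>2))) < c0 / 2"
    using small_amplitude[of "c0 / 2" "real n" T "real n / r"] c0(1) by (metis half_gt_zero)

  \<comment> \<open>The basis vector is turned by the angle reached at time \<open>T / 2\<close>, so
    that at the midpoint it appears in the rotating frame as the original basis vector.\<close>
  define W where "W j x = tent r (mid (fst (h j))) x *\<^sub>R rot (\<omega> (fst (h j)) * (T / 2)) (snd (h j))" for j x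
  obtain \<Omega> where \<Omega>: "continuous_on UNIV \<Omega>"
    "\<And>s r. s \<in> S \<Longrightarrow> \<bar>r - (1 + real (c s))\<bar> \<le> 1 / 4 \<Longrightarrow> \<Omega> r = \<omega> s"
    by (rule speed_profile[OF S, of c \<omega>], rule c\<omega>, assumption+, rule that) assumption+
  \<comment> \<open>Large enough to contain every circle together with its margin 1/4.\<close>
  define R where "R = 2 + (\<Sum>s\<in>S. real (c s))"
  have R: "1 + real (c s) + 1 / 4 \<le> R" if "s \<in> S" for s
    using member_le_sum[OF that, of "\<lambda>s. real (c s)"] S by (simp add: R_def)
  have \<rho>2: "\<rho>\<^sup>2 > 0" using \<rho>(1) by simp
  have "continuous_on UNIV (\<lambda>x. \<Omega> (norm x) *\<^sub>R rot_gen x)"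
    by (intro continuous_intros continuous_on_compose2[OF \<Omega>(1)]) auto
  \<comment> \<open>The tolerance \<open>\<rho>\<^sup>2\<close> is of second order against the
    displacement of order \<rho> produced by the parameters.\<close>
  from pushforward_dense[where \<F> = \<F> and R = R, OF dense \<psi> this \<rho>2]
  obtain V0 where V0: "V0 \<in> \<F>" "\<And>x. norm (\<psi> x) \<le> R \<Longrightarrow>
      norm (D x (V0 x) - \<Omega> (norm (\<psi> x)) *\<^sub>R rot_gen (\<psi> x)) \<le> \<rho>\<^sup>2" by blast
  have "\<exists>V\<in>\<F>. \<forall>x. norm (\<psi> x) \<le> R \<longrightarrow> norm (D x (V x) - W j (\<psi> x)) \<le> \<rho>\<^sup>2" for j
  proof -
    have "continuous_on UNIV (W j)" unfolding W_def by (intro continuous_intros r0)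
    from pushforward_dense[where \<F> = \<F> and R = R, OF dense \<psi> this \<rho>2] show ?thesis by blast
  qed
  then obtain V where V: "\<And>j. V j \<in> \<F>" "\<And>j x. norm (\<psi> x) \<le> R \<Longrightarrow> norm (D x (V j x) - W j (\<psi> x)) \<le> \<rho>\<^sup>2"
    by metis
  define comb where "comb p = (\<lambda>x. V0 x + (\<Sum>j<n. p j *\<^sub>R V j x))" for p
  have comb: "comb p \<in> \<F>" for p
    unfolding comb_def by (intro subspace_combination sub V0 V)

  \<comment> \<open>The endpoint error is measured after rotating back by the full angle; it
    vanishes in all directions exactly when the endpoint is \<open>P (\<sigma> s)\<close> in the new
    coordinates.\<close>
  define f where "f p j = (rot (- (\<omega> (fst (h j)) * T)) (\<psi> (flow (comb p) T (fst (h j)))) - P (fst (h j))) \<bullet> snd (h j)" for p j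
  have cont_f: "continuous_on UNIV (\<lambda>p. f p j)" for j
  proof -
    have "continuous_on UNIV (\<lambda>p. flow (comb p) T (fst (h j)))"
      unfolding comb_def
      by (rule continuous_on_flow_parameter)
         (use comb lip glob V(1) T in \<open>auto simp: comb_def intro: locally_lipschitz_imp_continuous\<close>)
    then show ?thesis
      unfolding f_def
      by (intro continuous_intros continuous_on_compose2[OF cont_\<psi>]) auto
  qed
  \<comment> \<open>The sign \<theta> treats opposite faces at once: it is moved into the test
    direction \<open>\<theta> *\<^sub>R e\<close>, along which the parameter vector has component
    \<open>\<theta> * \<theta> * \<rho> = \<rho>\<close> on either face.\<close>
  have face: "0 \<le> \<theta> * f p j"
    if j: "j < n" and p: "\<forall>i. \<bar>p i\<bar> \<le> \<rho>" and \<theta>: "\<bar>\<theta>\<bar> = 1" and pj: "p j = \<theta> * \<rho>" for p j \<theta>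
  proof -
    define s where "s = fst (h j)"
    define e where "e = snd (h j)"
    have s: "s \<in> S" and e: "e \<in> Basis" using hS[OF j] by (auto simp: s_def e_def)
    define z where "z t = flow (comb p) t s" for t
    have traj: "is_trajectory (comb p) s z"
      using is_trajectory_flow[OF lip[OF comb] glob[OF comb]] by (simp add: z_def[abs_def])
    define X where "X x = (\<Sum>i<n. p i *\<^sub>R W i x)" for x
    have X_bound: "norm (X x) \<le> real n * \<rho>" for x
    proof -
      have "norm (p i *\<^sub>R W i x) \<le> \<rho>" if "i < n" for i
      proof -
        have "\<bar>p i\<bar> * tent r (mid (fst (h i))) x \<le> \<rho> * 1"
          using p \<rho>(1) by (intro mult_mono tent_nonneg tent_le_1 r0) auto
        then show ?thesis
          using hS(2)[OF that] by (simp add: W_def abs_mult abs_of_nonneg[OF tent_nonneg])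
      qed
      then show ?thesis unfolding X_def using sum_norm_bound[of "{..<n}" "\<lambda>i. p i *\<^sub>R W i x" \<rho>] by simp
    qed
    have X_lip: "norm (X x - X x') \<le> (real n * \<rho> / r) * norm (x - x')" for x x'
    proof -
      have "norm (p i *\<^sub>R W i x - p i *\<^sub>R W i x') \<le> \<rho> * (norm (x - x') / r)" if "i < n" for i
      proof -
        have "norm (p i *\<^sub>R W i x - p i *\<^sub>R W i x') = \<bar>p i\<bar> * \<bar>tent r (mid (fst (h i))) x - tent r (mid (fst (h i))) x'\<bar>"
          using hS(2)[OF that] unfolding W_def
          by (simp add: abs_mult[symmetric] right_diff_distrib flip: scaleR_diff_left scaleR_diff_right)
        also have "\<dots> \<le> \<rho> * (norm (x - x') / r)"
          using p \<rho>(1) by (intro mult_mono tent_lipschitz[OF r0]) auto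
        finally show ?thesis .
      qed
      then have "norm (\<Sum>i<n. p i *\<^sub>R W i x - p i *\<^sub>R W i x') \<le> real (card {..<n}) * (\<rho> * (norm (x - x') / r))"
        by (intro sum_norm_bound) auto
      then show ?thesis by (simp add: X_def sum_subtractf mult.assoc)
    qed
    \<comment> \<open>The parameter vector attached to \<open>s\<close>, reassembled from its
      coordinates.\<close>
    define q where "q = (\<Sum>i<n. if fst (h i) = s then p i *\<^sub>R snd (h i) else 0)"
    have q_inner: "\<exists>i. q \<bullet> e' = p i \<and> h i = (s, e') \<and> i < n" if e': "e' \<in> Basis" for e'
    proof -
      obtain i where i: "i < n" "h i = (s, e')"
        using h_surj[OF s e'] by blast
      have "q \<bullet> e' = (\<Sum>k<n. if k = i then p i else 0)"
        unfolding q_def inner_sum_left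
      proof (rule sum.cong[OF refl])
        fix k assume k: "k \<in> {..<n}"
        show "(if fst (h k) = s then p k *\<^sub>R snd (h k) else 0) \<bullet> e' = (if k = i then p i else 0)"
        proof (cases "k = i")
          case True
          then show ?thesis using i(2) e' by simp
        next
          case False
          then have "h k \<noteq> h i"
            using h_inj k i(1) by blast
          then have "fst (h k) = s \<Longrightarrow> snd (h k) \<noteq> e'" using i(2) by (simp add: prod_eq_iff)
          then show ?thesis using False hS(2)[of k] k e' by (auto simp: inner_Basis)
        qed
      qed
      then show ?thesis using i by auto
    qed
    have qe: "q \<bullet> (\<theta> *\<^sub>R e) = \<rho>"
    proof -
      obtain i where i: "q \<bullet> e = p i" "h i = (s, e)" "i < n" using q_inner[OF e] by blast
      then have "i = j" using h_inj[of i j] j by (simp add: s_def e_def)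
      moreover have "\<theta> * \<theta> = 1" using \<theta> by (metis abs_mult_self_eq mult_1)
      ultimately show ?thesis using i(1) pj by (simp flip: mult.assoc)
    qed
    have "norm q \<le> (\<Sum>e'\<in>Basis. \<bar>q \<bullet> e'\<bar>)" by (rule norm_le_l1)
    also have "\<dots> \<le> (\<Sum>e'\<in>(Basis :: 'a set). \<rho>)"
      by (rule sum_mono) (metis p q_inner)
    finally have nq: "norm q \<le> real DIM('a) * \<rho>" by simp
    have rq: "r * norm q \<le> \<rho> / 2"
      using mult_left_mono[OF nq, of r] rN[OF \<rho>(1)] r0 by linarith
    \<comment> \<open>By the separation \<open>sep\<close>, all tents belonging to other points
      vanish along this arc.\<close>
    have X_arc: "X (rot (\<omega> s * t) (P s)) = w s t *\<^sub>R rot (\<omega> s * (T / 2)) q" if t: "t \<in> {0..T}" for t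
    proof -
      have "w s t *\<^sub>R rot (\<omega> s * (T / 2)) q
          = (\<Sum>i<n. w s t *\<^sub>R rot (\<omega> s * (T / 2)) (if fst (h i) = s then p i *\<^sub>R snd (h i) else 0))"
        unfolding q_def by (simp add: linear_sum[OF linear_rot] scaleR_sum_right)
      also have "\<dots> = X (rot (\<omega> s * t) (P s))"
        unfolding X_def
      proof (rule sum.cong[OF refl])
        fix i assume i: "i \<in> {..<n}"
        show "w s t *\<^sub>R rot (\<omega> s * (T / 2)) (if fst (h i) = s then p i *\<^sub>R snd (h i) else 0)
            = p i *\<^sub>R W i (rot (\<omega> s * t) (P s))"
        proof (cases "fst (h i) = s")
          case True
          then show ?thesis by (simp add: W_def w_def linear_scale[OF linear_rot])
        next
          case False
          then have "tent r (mid (fst (h i))) (rot (\<omega> s * t) (P s)) = 0"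
            using i hS(1)[of i] s t by (intro tent_eq_0[OF r0] sep) auto
          then show ?thesis using False by (simp add: W_def linear_0[OF linear_rot])
        qed
      qed
      finally show ?thesis ..
    qed
    have \<psi>z: "((\<lambda>t. \<psi> (z t)) has_vector_derivative D (z t) (comb p (z t))) (at t)" for t
      using vector_derivative_diff_chain_within[of z "comb p (z t)" t UNIV \<psi> "D (z t)"] traj D
      by (auto simp: is_trajectory_def o_def intro: has_derivative_at_withinI)
    have z0: "\<psi> (z 0) = P s" using traj \<psi>P[OF s] by (simp add: is_trajectory_def)
    \<comment> \<open>A displacement of at most 1/4 in the rotating frame changes the norm by at
      most 1/4, so the speed is exactly \<open>\<omega> s\<close>. One \<rho>^2 comes from
      \<open>V0\<close>, the other from all perturbations together.\<close>
    have near: "norm (D (z t) (comb p (z t)) - \<omega> s *\<^sub>R rot_gen (\<psi> (z t)) - X (\<psi> (z t))) \<le> 2 * \<rho>\<^sup>2"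
      if "norm (rot (- (\<omega> s * t)) (\<psi> (z t)) - \<psi> (z 0)) \<le> 1 / 4" for t
    proof -
      have rad: "\<bar>norm (\<psi> (z t)) - (1 + real (c s))\<bar> \<le> 1 / 4"
        using norm_triangle_ineq3[of "rot (- (\<omega> s * t)) (\<psi> (z t))" "P s"] that normP[OF s] by (simp add: z0)
      have \<Omega>s: "\<Omega> (norm (\<psi> (z t))) = \<omega> s"
        by (rule \<Omega>(2)[OF s rad])
      have Rz: "norm (\<psi> (z t)) \<le> R"
        using rad R[OF s] unfolding abs_le_iff by linarith
      have "D (z t) (comb p (z t)) - \<omega> s *\<^sub>R rot_gen (\<psi> (z t)) - X (\<psi> (z t))
          = (D (z t) (V0 (z t)) - \<Omega> (norm (\<psi> (z t))) *\<^sub>R rot_gen (\<psi> (z t)))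
            + (\<Sum>i<n. p i *\<^sub>R (D (z t) (V i (z t)) - W i (\<psi> (z t))))"
        by (simp add: comb_def X_def \<Omega>s linear_add[OF D_lin] linear_sum[OF D_lin] linear_scale[OF D_lin]
            scaleR_diff_right sum_subtractf)
      also have "norm \<dots> \<le> \<rho>\<^sup>2 + real n * (\<rho> * \<rho>\<^sup>2)"
      proof (rule norm_triangle_mono[OF V0(2)[OF Rz]])
        have "norm (p i *\<^sub>R (D (z t) (V i (z t)) - W i (\<psi> (z t)))) \<le> \<rho> * \<rho>\<^sup>2" for i
          using p \<rho>(1) V(2)[OF Rz, of i] by (simp add: mult_mono)
        then show "norm (\<Sum>i<n. p i *\<^sub>R (D (z t) (V i (z t)) - W i (\<psi> (z t)))) \<le> real n * (\<rho> * \<rho>\<^sup>2)"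
          using sum_norm_bound[of "{..<n}" "\<lambda>i. p i *\<^sub>R (D (z t) (V i (z t)) - W i (\<psi> (z t)))" "\<rho> * \<rho>\<^sup>2"] by simp
      qed
      also have "real n * (\<rho> * \<rho>\<^sup>2) \<le> \<rho>\<^sup>2"
        using mult_right_mono[OF \<rho>(2), of "\<rho>\<^sup>2"] by (simp add: mult.assoc)
      finally show ?thesis by simp
    qed
    have ne: "norm (\<theta> *\<^sub>R e) = 1" using e \<theta> by simp
    have "\<rho> / 2 * integral {0..T} (w s) - T * (2 * \<rho>\<^sup>2 + real n * \<rho> / r * (T * (real n * \<rho> + 2 * \<rho>\<^sup>2)))
        \<le> (rot (- (\<omega> s * T)) (\<psi> (z T)) - \<psi> (z 0)) \<bullet> (\<theta> *\<^sub>R e)"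
    \<comment> \<open>Applied with gain factor \<open>\<rho> / 2\<close>, field error
      \<open>2 * \<rho>\<^sup>2\<close>, size \<open>n * \<rho>\<close> and Lipschitz constant
      \<open>n * \<rho> / r\<close> of the perturbation.\<close>
    proof (rule rotating_displacement[where r = "1 / 4" and X = X, OF \<psi>z near X_bound X_lip _ \<rho>(3) _ _ ne cont_w])
      show "\<rho> / 2 * w s t \<le> rot (- (\<omega> s * t)) (X (rot (\<omega> s * t) (\<psi> (z 0)))) \<bullet> (\<theta> *\<^sub>R e)" if "t \<in> {0..T}" for t
        unfolding z0 X_arc[OF that] w_def mid_def
        by (rule tent_drive[OF plane[OF s] _ ne r0 rq]) (use normP[OF s] qe in auto)
    qed (use T \<rho>(1) r0 in auto)
    also have "\<dots> = \<theta> * f p j"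
      unfolding z0 by (simp add: f_def s_def[symmetric] e_def[symmetric] z_def)
    finally have low: "\<rho> / 2 * integral {0..T} (w s)
        - T * (2 * \<rho>\<^sup>2 + real n * \<rho> / r * (T * (real n * \<rho> + 2 * \<rho>\<^sup>2))) \<le> \<theta> * f p j" .
    \<comment> \<open>The whole error has a factor \<rho>; what is left is below
      \<open>c0 / 2\<close>, whereas the gain is at least \<open>\<rho> * c0 / 2\<close>.\<close>
    have "T * (2 * \<rho>\<^sup>2 + real n * \<rho> / r * (T * (real n * \<rho> + 2 * \<rho>\<^sup>2)))
        = \<rho> * (T * (2 * \<rho> + real n / r * (T * (real n * \<rho> + 2 * \<rho>\<^sup>2))))"
      by (simp add: power2_eq_square algebra_simps)
    also have "\<dots> \<le> \<rho> * (c0 / 2)"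
      using \<rho>(1,4) by (intro mult_left_mono) auto
    also have "\<dots> \<le> \<rho> / 2 * integral {0..T} (w s)"
      using mult_left_mono[OF c0(2)[OF s], of "\<rho> / 2"] \<rho>(1) by simp
    finally show ?thesis using low by linarith
  qed
  obtain p where p: "\<And>j. j < n \<Longrightarrow> f p j = 0"
  proof (rule poincare_miranda[OF \<rho>(1), of n f])
    show "f p j \<le> 0" if "j < n" "\<forall>i. \<bar>p i\<bar> \<le> \<rho>" "p j = - \<rho>" for p j
      using face[OF that(1,2), of "- 1"] that(3) by simp
    show "0 \<le> f p j" if "j < n" "\<forall>i. \<bar>p i\<bar> \<le> \<rho>" "p j = \<rho>" for p j
      using face[OF that(1,2), of 1] that(3) by simp
  qed (use cont_f in auto)
  have "flow (comb p) T s = \<sigma> s" if s: "s \<in> S" for s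
  proof -
    have "rot (- (\<omega> s * T)) (\<psi> (flow (comb p) T s)) = P s"
    proof (rule euclidean_eqI)
      fix e :: 'a assume e: "e \<in> Basis"
      obtain j where "j < n" "h j = (s, e)"
        using h_surj[OF s e] by blast
      then show "rot (- (\<omega> s * T)) (\<psi> (flow (comb p) T s)) \<bullet> e = P s \<bullet> e"
        using p[of j] by (simp add: f_def inner_diff_left)
    qed
    then have "\<psi> (flow (comb p) T s) = P (\<sigma> s)"
      using P\<sigma>[OF s] by (metis rot_rot_neg)
    also have "\<dots> = \<psi> (\<sigma> s)" using \<psi>P s \<sigma> by (simp add: permutes_in_image)
    finally show ?thesis using \<phi>\<psi> by metis
  qed
  then show ?thesis using comb by blast
qed

end

text \<open>Coincidences between inputs and targets do no harm: the data form a bijection between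
  two subsets of their union.\<close>

lemma admissible_extends_to_permutation:
  fixes x y :: "nat \<Rightarrow> 'a"
  assumes "admissible M x y"
  obtains \<sigma> S where "finite S" "\<sigma> permutes S" "\<And>i. i \<in> {1..M} \<Longrightarrow> x i \<in> S \<and> \<sigma> (x i) = y i"
proof -
  let ?X = "x ` {1..M}" and ?Y = "y ` {1..M}"
  have x: "inj_on x {1..M}" and y: "inj_on y {1..M}" using assms by (auto simp: admissible_def)
  have "bij_betw (y \<circ> the_inv_into {1..M} x) ?X ?Y"
    using x y by (intro bij_betw_trans[OF bij_betw_the_inv_into]) (auto intro: inj_on_imp_bij_betw)
  then obtain \<sigma> where "\<sigma> permutes ?X \<union> ?Y" "\<And>v. v \<in> ?X \<Longrightarrow> \<sigma> v = (y \<circ> the_inv_into {1..M} x) v"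
    by (rule bij_betw_extends_to_permutation[of "?X \<union> ?Y", rotated 3]) auto
  then show thesis
    using x by (intro that[of "?X \<union> ?Y" \<sigma>]) (auto simp: the_inv_into_f_f)
qed

theorem theorem2p4:
  fixes \<F> :: "(real ^ 'n \<Rightarrow> real ^ 'n) set"
  assumes "CARD('n) \<ge> 2"
    and "field_space.subspace \<F>"
    and "\<And>V. V \<in> \<F> \<Longrightarrow> locally_lipschitz V"
    and "\<And>V. V \<in> \<F> \<Longrightarrow> generates_global_flow V"
    and "\<And>u R \<epsilon>. u \<in> Cc_infinity \<Longrightarrow> R > 0 \<Longrightarrow> \<epsilon> > 0 \<Longrightarrow>
           \<exists>V\<in>\<F>. (SUP x\<in>cball 0 R. norm (V x - u x)) < (\<epsilon>::real)"
  shows "\<forall>T>0. \<forall>M\<ge>1. \<forall>x y. admissible M x y \<longrightarrow>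
           (\<exists>V\<in>\<F>. \<forall>i\<in>{1..M}. flow V T (x i) = y i)"
proof (intro allI impI)
  fix T :: real and M :: nat and x y :: "nat \<Rightarrow> real ^ 'n"
  assume T: "T > 0" and "M \<ge> 1" and adm: "admissible M x y"
  obtain \<sigma> S where S: "finite S" "\<sigma> permutes S" and \<sigma>: "\<And>i. i \<in> {1..M} \<Longrightarrow> x i \<in> S \<and> \<sigma> (x i) = y i"
    by (rule admissible_extends_to_permutation[OF adm], rule that) assumption+
  have dense: "\<exists>V\<in>\<F>. \<forall>x. norm x \<le> R \<longrightarrow> norm (V x - U x) < e"
    if "continuous_on UNIV U" "e > 0" for U :: "real ^ 'n \<Rightarrow> real ^ 'n" and R e :: real
    using dense_in_continuous_fields[OF assms(3,5) that, of R] by metis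
  \<comment> \<open>Two different coordinate axes span the plane of rotation.\<close>
  have "\<not> is_singleton (UNIV :: 'n set)" using assms(1) by (auto simp: is_singleton_altdef)
  then obtain k l :: 'n where "k \<noteq> l" by (metis UNIV_I is_singletonI' empty_iff)
  then interpret orthonormal_pair "axis k 1 :: real ^ 'n" "axis l 1"
    by unfold_locales (auto simp: inner_axis_axis)
  have "\<exists>V\<in>\<F>. \<forall>s\<in>S. flow V T s = \<sigma> s"
    by (rule permutation_realized[OF _ assms(2-4) dense S T]) (use assms(1) in simp_all)
  then show "\<exists>V\<in>\<F>. \<forall>i\<in>{1..M}. flow V T (x i) = y i"
    using \<sigma> by metis
qed

end
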